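(* Let $F$ be a number field of degree $n=[F:\mathbb{Q}]$ with $s=n-2>0$ real embeddings $\sigma_1,\dots,\sigma_s$ and exactly two non-real embeddings $\sigma_{s+1},\overline{\sigma_{s+1}}$. Let $M=M(F,\mathcal{O}_F^{*,+})$ be the Oeljeklaus–Toma manifold with the locally conformal K\"ahler structure given by the K\"ahler potential $\phi$ below, so that $\dim_\mathbb{C}M=n-1$, $b_1(M)=n-2$, and the rank $r(M)$ of $M$ equals the rank of the multiplicative group $\{|\sigma_{s+1}(u)|^2: u\in\mathcal{O}_F^{*,+}\}\subset\mathbb{R}_{>0}$. Then: (1) If $n$ is odd, the map $u\mapsto|\sigma_{s+1}(u)|^2$ is injective on $\mathcal{O}_F^{*,+}$, and $r(M)=b_1(M)=n-2$. (2) If $n$ is even, then either $r(M)=b_1(M)=n-2$ or $r(M)=b_1(M)/2=(n-2)/2$; the latter occurs if and only if $F$ is a quadratic extension of a totally real number field.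
   Context: Notation: $\sigma_1,\dots,\sigma_n$ are the complex embeddings of $F$; $\mathcal{O}_F$ the ring of integers; $\mathcal{O}_F^{*,+}$ the units of $\mathcal{O}_F$ that are positive under every real embedding. With $t=1$, $\mathcal{O}_F^{*,+}$ is admissible and $M(F,\mathcal{O}_F^{*,+})=(\mathbb{H}^s\times\mathbb{C})/(\mathcal{O}_F\rtimes\mathcal{O}_F^{*,+})$, where $a\in\mathcal{O}_F$ acts by $T_a(z)=(z_1+\sigma_1(a),\dots,z_{s+1}+\sigma_{s+1}(a))$ and $u\in\mathcal{O}_F^{*,+}$ by $R_u(z)=(\sigma_1(u)z_1,\dots,\sigma_{s+1}(u)z_{s+1})$. The K\"ahler metric on $\mathbb{H}^s\times\mathbb{C}$ is $i\partial\bar\partial\phi$ with $\phi(z)=\prod_{j=1}^s\frac{i}{z_j-\bar z_j}+|z_{s+1}|^2$; the $T_a$ are isometries and $R_u^*\phi=|\sigma_{s+1}(u)|^2\phi$, so $(\mathbb{H}^s\times\mathbb{C},\mathcal{O}_F\rtimes\mathcal{O}_F^{*,+})$ is an \textsc{lck}-presentation of $M$. The rank $r(M)$ of an lcK manifold presented as $(K,\Gamma)$ is the rank of the subgroup of $\mathbb{R}_{>0}$ formed by the dilation factors of the elements of $\Gamma$. *)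

theory Defs
  imports "HOL-Analysis.Analysis" "HOL-Computational_Algebra.Polynomial"
begin

text \<open>Number fields are modelled as subfields of the complex numbers of finite degree over Q.\<close>

definition is_subfield :: "complex set \<Rightarrow> bool" where
  "is_subfield S \<longleftrightarrow> 0 \<in> S \<and> 1 \<in> S \<and>
     (\<forall>x\<in>S. \<forall>y\<in>S. x + y \<in> S \<and> x * y \<in> S) \<and>
     (\<forall>x\<in>S. - x \<in> S \<and> inverse x \<in> S)"

text \<open>[F:K] = d for subfields K \<subseteq> F: F has a K-basis of d elements.\<close>
definition field_degree :: "complex set \<Rightarrow> complex set \<Rightarrow> nat \<Rightarrow> bool" where
  "field_degree K F d \<longleftrightarrow>
     (\<exists>b :: nat \<Rightarrow> complex. (\<forall>i<d. b i \<in> F) \<and>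
        (\<forall>x\<in>F. \<exists>!c :: nat \<Rightarrow> complex. (\<forall>i<d. c i \<in> K) \<and> (\<forall>i\<ge>d. c i = 0) \<and>
                    x = (\<Sum>i<d. c i * b i)))"

definition number_field :: "complex set \<Rightarrow> bool" where
  "number_field F \<longleftrightarrow> is_subfield F \<and> (\<exists>d. field_degree \<rat> F d)"

text \<open>Complex embeddings of F (field homomorphisms F \<rightarrow> C, extended by 0 outside F).\<close>
definition embeddings :: "complex set \<Rightarrow> (complex \<Rightarrow> complex) set" where
  "embeddings F = {\<sigma>. (\<forall>x\<in>F. \<forall>y\<in>F. \<sigma> (x + y) = \<sigma> x + \<sigma> y \<and> \<sigma> (x * y) = \<sigma> x * \<sigma> y)
                      \<and> \<sigma> 1 = 1 \<and> (\<forall>x. x \<notin> F \<longrightarrow> \<sigma> x = 0)}"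

definition real_embeddings :: "complex set \<Rightarrow> (complex \<Rightarrow> complex) set" where
  "real_embeddings F = {\<sigma>\<in>embeddings F. \<sigma> ` F \<subseteq> \<real>}"

definition nonreal_embeddings :: "complex set \<Rightarrow> (complex \<Rightarrow> complex) set" where
  "nonreal_embeddings F = embeddings F - real_embeddings F"

definition totally_real :: "complex set \<Rightarrow> bool" where
  "totally_real K \<longleftrightarrow> embeddings K = real_embeddings K"

definition algebraic_integer :: "complex \<Rightarrow> bool" where
  "algebraic_integer x \<longleftrightarrow> (\<exists>p :: int poly. lead_coeff p = 1 \<and> poly (map_poly of_int p) x = 0)"

text \<open>Ring of integers O_F.\<close>
definition ring_of_integers :: "complex set \<Rightarrow> complex set" where
  "ring_of_integers F = {x\<in>F. algebraic_integer x}"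

text \<open>Totally positive units O_F^{*,+}.\<close>
definition totally_positive_units :: "complex set \<Rightarrow> complex set" where
  "totally_positive_units F =
     {u \<in> ring_of_integers F. u \<noteq> 0 \<and> inverse u \<in> ring_of_integers F \<and>
        (\<forall>\<sigma>\<in>real_embeddings F. Re (\<sigma> u) > 0)}"

text \<open>Rank of a subgroup of the multiplicative group R_{>0}: maximal number of
  multiplicatively (i.e. Z-linearly) independent elements.\<close>
definition mult_indep :: "real set \<Rightarrow> bool" where
  "mult_indep S \<longleftrightarrow> finite S \<and> (\<forall>x\<in>S. x > 0) \<and>
     (\<forall>k :: real \<Rightarrow> int. (\<Prod>x\<in>S. x powi k x) = 1 \<longrightarrow> (\<forall>x\<in>S. k x = 0))"

definition has_mult_rank :: "real set \<Rightarrow> nat \<Rightarrow> bool" where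
  "has_mult_rank G r \<longleftrightarrow> (\<exists>S\<subseteq>G. mult_indep S \<and> card S = r) \<and>
                          (\<forall>S\<subseteq>G. mult_indep S \<longrightarrow> card S \<le> r)"

text \<open>Dilation factors of the deck group O_F \<rtimes> O_F^{*,+} acting on H^s \<times> C with
  potential phi: T_a is an isometry (factor 1 on phi), R_u multiplies phi by |tau(u)|^2,
  where tau = sigma_{s+1} is the (chosen) non-real embedding.\<close>
definition OT_dilation_factors :: "complex set \<Rightarrow> (complex \<Rightarrow> complex) \<Rightarrow> real set" where
  "OT_dilation_factors F \<tau> =
     {(cmod (\<tau> u))\<^sup>2 | a u. a \<in> ring_of_integers F \<and> u \<in> totally_positive_units F}"

text \<open>r(M) for the OT manifold M(F, O_F^{*,+}) with this lcK presentation.\<close>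
definition OT_rank_is :: "complex set \<Rightarrow> (complex \<Rightarrow> complex) \<Rightarrow> nat \<Rightarrow> bool" where
  "OT_rank_is F \<tau> r \<longleftrightarrow> has_mult_rank (OT_dilation_factors F \<tau>) r"

end

theory Submission
  imports Defs "Jordan_Normal_Form.Char_Poly"
begin

text \<open>Write \<open>U\<close> for the totally positive units. The dichotomy is whether \<open>\<tau> ` F\<close> is stable under complex
  conjugation, which happens exactly when \<open>F\<close> is quadratic over the totally real field
  \<open>{x \<in> F. \<tau> x \<in> \<real>}\<close>.

  If some \<open>u \<noteq> 1\<close> in \<open>U\<close> has \<open>\<bar>\<tau> u\<bar> = 1\<close>, then \<open>\<tau> u\<close> is not real, hence a simple root of the
  characteristic polynomial of \<open>u\<close>, so \<open>F = \<rat>(u)\<close>; as the conjugate of \<open>\<tau> u\<close> is \<open>\<tau> (1 / u)\<close>,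
  \<open>\<tau> ` F\<close> is stable under conjugation. Conversely, stability provides an involution \<open>\<iota>\<close> of \<open>F\<close>
  with \<open>\<tau> \<circ> \<iota>\<close> the conjugate of \<open>\<tau>\<close>. It pairs off the real embeddings, so \<open>n\<close> is even, and
  \<open>\<bar>\<tau> u\<bar>\<^sup>2 = \<tau> (u * \<iota> u)\<close> depends only on the relative norm, whose logarithms are constant on the
  pairs.

  In both cases the rank is computed as in Dirichlet's unit theorem: units that are large at one real
  embedding and small at all other embeddings give a diagonally dominant matrix of logarithms, and
  the discreteness of the integers bounds the rank from above. Both the existence of these units and the
  upper bound follow from the pigeonhole principle, without Minkowski's theorem.\<close>

section \<open>Algebraic integers\<close>

text \<open>Rationality of the product of the factors \<open>[:- \<sigma> x, 1:]\<close> over all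
  embeddings carries most of the algebra: it makes norms rational, moves a multiple root from one
  conjugate to another, and confines the embeddings of a subfield to values of embeddings of
  \<open>F\<close>. It rests on the number of embeddings being exactly \<open>n\<close>, which makes
  the matrix of conjugates of a basis square. By the product formula the real embeddings determine
  the absolute value at \<open>\<tau>\<close> of a unit, so the logarithms at the real embeddings,
  summed over blocks (single embeddings, or pairs exchanged by the involution), serve as
  coordinates. The obstacle is that a dilation factor sees only \<open>\<tau>\<close>: a relation
  between dilation factors has to become a relation between units, which is where triviality of the
  kernel, or else the passage to the relative norm, enters. For the upper bound, the exponent
  vectors with entries in \<open>{0..H}\<close> grow like \<open>H\<close> to the number of
  independent factors, the boxes of coordinates like \<open>H\<close> to the number of blocks, and
  each box receives a bounded number of vectors.\<close>

lemma algebraic_integer_eigenvalue: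
  fixes v :: "nat \<Rightarrow> complex" and A :: "nat \<Rightarrow> nat \<Rightarrow> int"
  assumes eq: "\<And>k. k < m \<Longrightarrow> x * v k = (\<Sum>l<m. of_int (A k l) * v l)"
    and nz: "k0 < m" "v k0 \<noteq> 0"
  shows "algebraic_integer x"
proof -
  define M where "M = mat m m (\<lambda>(k, l). A k l)"
  have M: "M \<in> carrier_mat m m" by (simp add: M_def)
  let ?C = "map_mat of_int M :: complex mat"
  have C: "?C \<in> carrier_mat m m" using M by simp
  \<comment> \<open>The equations say that \<open>x\<close> is an eigenvalue of an integer matrix,
    hence a root of its characteristic polynomial, which is monic with integer coefficients.\<close>
  have "eigenvector ?C (vec m v) x"
    unfolding eigenvector_def
  proof (intro conjI)
    show "vec m v \<in> carrier_vec (dim_row ?C)" using M by auto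
    show "vec m v \<noteq> 0\<^sub>v (dim_row ?C)"
    proof
      assume "vec m v = 0\<^sub>v (dim_row ?C)"
      then have "vec_index (vec m v) k0 = vec_index (0\<^sub>v (dim_row ?C)) k0" by simp
      then show False using nz M by (simp add: M_def)
    qed
    show "?C *\<^sub>v vec m v = x \<cdot>\<^sub>v vec m v"
      by (rule eq_vecI) (auto simp: M_def scalar_prod_def eq lessThan_atLeast0)
  qed
  then have "poly (char_poly ?C) x = 0"
    using eigenvalue_root_char_poly[OF C] by (auto simp: eigenvalue_def)
  moreover have "char_poly ?C = map_poly of_int (char_poly M)"
    by (rule of_int_hom.char_poly_hom[OF M])
  moreover have "lead_coeff (char_poly M) = 1"
    using degree_monic_char_poly[OF M] by auto
  ultimately show ?thesis unfolding algebraic_integer_def by auto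
qed

lemma algebraic_integer_eigenvalue_finite:
  fixes v :: "'i \<Rightarrow> complex" and A :: "'i \<Rightarrow> 'i \<Rightarrow> int"
  assumes "finite I" and eq: "\<And>k. k \<in> I \<Longrightarrow> x * v k = (\<Sum>l\<in>I. of_int (A k l) * v l)"
    and nz: "k0 \<in> I" "v k0 \<noteq> 0"
  shows "algebraic_integer x"
proof -
  obtain h where h: "bij_betw h {..<card I} I"
    using ex_bij_betw_nat_finite[OF \<open>finite I\<close>] by (auto simp: atLeast0LessThan)
  have "k0 \<in> h ` {..<card I}" using h nz(1) by (simp add: bij_betw_def)
  then obtain j0 where j0: "j0 < card I" "h j0 = k0" by blast
  show ?thesis
  proof (rule algebraic_integer_eigenvalue[where v="v \<circ> h" and A="\<lambda>k l. A (h k) (h l)" and m="card I"])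
    fix k assume "k < card I"
    then have "h k \<in> I" using h by (auto simp: bij_betw_def)
    then have "x * v (h k) = (\<Sum>l\<in>I. of_int (A (h k) l) * v l)" by (rule eq)
    also have "\<dots> = (\<Sum>l<card I. of_int (A (h k) (h l)) * v (h l))"
      by (rule sum.reindex_bij_betw[OF h, symmetric])
    finally show "x * (v \<circ> h) k = (\<Sum>l<card I. of_int (A (h k) (h l)) * (v \<circ> h) l)" by simp
  qed (use j0 nz in auto)
qed

text \<open>\<open>A\<close> is the companion matrix of a monic equation of \<open>x\<close>: every
  row but the last shifts the exponent, and the last one rewrites \<open>x ^ d\<close> by the
  equation.\<close>

lemma algebraic_integer_powers:
  assumes "algebraic_integer x"
  obtains d :: nat and A :: "nat \<Rightarrow> nat \<Rightarrow> int"
  where "d > 0" "\<And>i. i < d \<Longrightarrow> x * x ^ i = (\<Sum>k<d. of_int (A i k) * x ^ k)"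
proof -
  obtain p :: "int poly" where p: "lead_coeff p = 1" "poly (map_poly of_int p) x = 0"
    using assms by (auto simp: algebraic_integer_def)
  define d where "d = degree p"
  have d: "d > 0"
  proof (rule ccontr)
    assume "\<not> d > 0"
    then obtain c where c: "p = [:c:]" by (auto simp: d_def elim: degree_eq_zeroE)
    then show False using p by simp
  qed
  have "0 = (\<Sum>k\<le>d. of_int (coeff p k) * x ^ k)"
    using p(2) by (simp add: poly_altdef d_def)
  also have "\<dots> = x ^ d + (\<Sum>k<d. of_int (coeff p k) * x ^ k)"
    using p(1) by (simp add: d_def lessThan_Suc_atMost[symmetric])
  finally have xd: "x ^ d = (\<Sum>k<d. of_int (- coeff p k) * x ^ k)"
    by (simp add: sum_negf eq_neg_iff_add_eq_0)
  define A where "A = (\<lambda>i k. if Suc i < d then (if k = Suc i then 1 else 0) else - coeff p k)"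
  show thesis
  proof (rule that[OF d, of A])
    fix i assume i: "i < d"
    show "x * x ^ i = (\<Sum>k<d. of_int (A i k) * x ^ k)"
    proof (cases "Suc i < d")
      case True
      then have "(\<Sum>k<d. of_int (A i k) * x ^ k) = (\<Sum>k<d. if k = Suc i then x ^ k else 0)"
        by (intro sum.cong) (auto simp: A_def)
      also have "\<dots> = x ^ Suc i" using True by simp
      finally show ?thesis by simp
    next
      case False
      then have "Suc i = d" using i by simp
      then show ?thesis using xd False by (simp add: A_def flip: power_Suc)
    qed
  qed
qed

text \<open>The monomials \<open>x ^ i * y ^ j\<close> span a finitely generated module stable under
  \<open>x\<close> and \<open>y\<close>. On it \<open>x * y\<close> acts by the Kronecker product of
  the two companion matrices and \<open>x + y\<close> by their Kronecker sum, where
  \<open>dl\<close> is the identity matrix. The monomial 1 is the nonzero entry of the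
  eigenvector.\<close>

lemma
  assumes "algebraic_integer x" "algebraic_integer y"
  shows algebraic_integer_add: "algebraic_integer (x + y)"
    and algebraic_integer_mult: "algebraic_integer (x * y)"
proof -
  obtain d A where A: "d > 0" "\<And>i. i < d \<Longrightarrow> x * x ^ i = (\<Sum>k<d. of_int (A i k) * x ^ k)"
    using algebraic_integer_powers[OF assms(1)] by metis
  obtain e B where B: "e > 0" "\<And>i. i < e \<Longrightarrow> y * y ^ i = (\<Sum>k<e. of_int (B i k) * y ^ k)"
    using algebraic_integer_powers[OF assms(2)] by metis
  define I where "I = {..<d} \<times> {..<e}"
  define v where "v = (\<lambda>(i, j). x ^ i * y ^ j)"
  have fin: "finite I" by (simp add: I_def)
  have nz: "(0, 0) \<in> I" "v (0, 0) \<noteq> 0" using A(1) B(1) by (auto simp: I_def v_def)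
  define dl :: "nat \<Rightarrow> nat \<Rightarrow> int" where "dl = (\<lambda>i j. if i = j then 1 else 0)"
  have prod: "(\<Sum>l\<in>I. of_int (P (fst l) * Q (snd l)) * v l)
      = (\<Sum>k<d. of_int (P k) * x ^ k) * (\<Sum>k<e. of_int (Q k) * y ^ k)" for P Q :: "nat \<Rightarrow> int"
    unfolding I_def v_def sum_product sum.cartesian_product
    by (intro sum.cong) (auto simp: algebra_simps)
  have dx: "(\<Sum>k<d. of_int (dl i k) * x ^ k) = x ^ i" if "i < d" for i
  proof -
    have "(\<Sum>k<d. of_int (dl i k) * x ^ k) = (\<Sum>k<d. if i = k then x ^ k else 0)"
      by (intro sum.cong) (auto simp: dl_def)
    then show ?thesis using that by simp
  qed
  have dy: "(\<Sum>k<e. of_int (dl i k) * y ^ k) = y ^ i" if "i < e" for i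
  proof -
    have "(\<Sum>k<e. of_int (dl i k) * y ^ k) = (\<Sum>k<e. if i = k then y ^ k else 0)"
      by (intro sum.cong) (auto simp: dl_def)
    then show ?thesis using that by simp
  qed
  show "algebraic_integer (x * y)"
  proof (rule algebraic_integer_eigenvalue_finite[where I=I and v=v and ?k0.0="(0, 0)" and A="\<lambda>k l. A (fst k) (fst l) * B (snd k) (snd l)"])
    fix k assume k: "k \<in> I"
    have "x * y * v k = (x * x ^ fst k) * (y * y ^ snd k)"
      by (simp add: v_def case_prod_beta algebra_simps)
    also have "\<dots> = (\<Sum>l<d. of_int (A (fst k) l) * x ^ l) * (\<Sum>l<e. of_int (B (snd k) l) * y ^ l)"
      using k by (simp add: I_def mem_Times_iff A(2)[of "fst k"] B(2)[of "snd k"])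
    finally show "x * y * v k = (\<Sum>l\<in>I. of_int (A (fst k) (fst l) * B (snd k) (snd l)) * v l)"
      unfolding prod .
  qed (use fin nz in auto)
  show "algebraic_integer (x + y)"
  proof (rule algebraic_integer_eigenvalue_finite[where I=I and v=v and ?k0.0="(0, 0)" and
        A="\<lambda>k l. A (fst k) (fst l) * dl (snd k) (snd l) + dl (fst k) (fst l) * B (snd k) (snd l)"])
    fix k assume k: "k \<in> I"
    have "(x + y) * v k = (x * x ^ fst k) * y ^ snd k + x ^ fst k * (y * y ^ snd k)"
      by (simp add: v_def case_prod_beta algebra_simps)
    also have "\<dots> = (\<Sum>l<d. of_int (A (fst k) l) * x ^ l) * (\<Sum>l<e. of_int (dl (snd k) l) * y ^ l)
        + (\<Sum>l<d. of_int (dl (fst k) l) * x ^ l) * (\<Sum>l<e. of_int (B (snd k) l) * y ^ l)"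
      using k by (simp add: I_def mem_Times_iff A(2)[of "fst k"] B(2)[of "snd k"] dx[of "fst k"] dy[of "snd k"])
    finally show "(x + y) * v k = (\<Sum>l\<in>I. of_int (A (fst k) (fst l) * dl (snd k) (snd l)
        + dl (fst k) (fst l) * B (snd k) (snd l)) * v l)"
      unfolding prod[symmetric] sum.distrib[symmetric] by (simp only: of_int_add distrib_right)
  qed (use fin nz in auto)
qed

lemma algebraic_integer_of_int: "algebraic_integer (of_int k)"
  unfolding algebraic_integer_def
  by (rule exI[of _ "[:-k, 1:]"]) simp

lemma algebraic_integer_prod:
  "(\<And>i. i \<in> I \<Longrightarrow> algebraic_integer (f i)) \<Longrightarrow> algebraic_integer (\<Prod>i\<in>I. f i)"
  using algebraic_integer_of_int[of 1]
  by (induction I rule: infinite_finite_induct) (auto intro: algebraic_integer_mult)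

lemma algebraic_integer_uminus: "algebraic_integer x \<Longrightarrow> algebraic_integer (- x)"
  using algebraic_integer_mult[of "of_int (-1)" x] algebraic_integer_of_int[of "-1"] by simp

lemma rational_algebraic_integer:
  assumes "algebraic_integer x" "x \<in> \<rat>"
  shows "x \<in> \<int>"
proof -
  obtain p :: "int poly" where "lead_coeff p = 1" "poly (map_poly of_int p) x = 0"
    using assms by (auto simp: algebraic_integer_def)
  then have "algebraic_int x"
    unfolding algebraic_int_altdef_ipoly by blast
  then show ?thesis using assms(2) by (rule rational_algebraic_int_is_int)
qed

section \<open>Embeddings and characteristic polynomials\<close>

locale subfield_of_complex =
  fixes F :: "complex set"
  assumes subfield: "is_subfield F"
begin

lemma zero_in [simp, intro]: "0 \<in> F" and one_in [simp, intro]: "1 \<in> F"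
  and add_in [intro]: "x \<in> F \<Longrightarrow> y \<in> F \<Longrightarrow> x + y \<in> F"
  and mult_in [intro]: "x \<in> F \<Longrightarrow> y \<in> F \<Longrightarrow> x * y \<in> F"
  and uminus_in [intro]: "x \<in> F \<Longrightarrow> - x \<in> F"
  and inverse_in [intro]: "x \<in> F \<Longrightarrow> inverse x \<in> F"
  using subfield by (auto simp: is_subfield_def)

lemma diff_in [intro]: "x \<in> F \<Longrightarrow> y \<in> F \<Longrightarrow> x - y \<in> F"
  using add_in[of x "- y"] by auto

lemma divide_in [intro]: "x \<in> F \<Longrightarrow> y \<in> F \<Longrightarrow> x / y \<in> F"
  using mult_in[of x "inverse y"] by (auto simp: divide_inverse)

lemma power_in [intro]: "x \<in> F \<Longrightarrow> x ^ k \<in> F"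
  by (induction k) auto

lemma powi_in [intro]: "x \<in> F \<Longrightarrow> x powi k \<in> F"
  by (auto simp: power_int_def)

lemma sum_in [intro]: "(\<And>i. i \<in> I \<Longrightarrow> f i \<in> F) \<Longrightarrow> (\<Sum>i\<in>I. f i) \<in> F"
  by (induction I rule: infinite_finite_induct) auto

lemma prod_in [intro]: "(\<And>i. i \<in> I \<Longrightarrow> f i \<in> F) \<Longrightarrow> (\<Prod>i\<in>I. f i) \<in> F"
  by (induction I rule: infinite_finite_induct) auto

lemma of_nat_in [simp, intro]: "of_nat k \<in> F"
  by (induction k) auto

lemma of_int_in [simp, intro]: "of_int k \<in> F"
  by (cases k) (auto simp del: of_nat_Suc)

lemma Rats_in: "x \<in> \<rat> \<Longrightarrow> x \<in> F"
  by (auto elim!: Rats_cases')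

lemma of_rat_in [simp, intro]: "of_rat q \<in> F"
  by (rule Rats_in) simp

lemma poly_in: "x \<in> F \<Longrightarrow> poly (map_poly of_rat p) x \<in> F"
  by (auto simp: poly_altdef)

context
  fixes \<sigma>
  assumes \<sigma>: "\<sigma> \<in> embeddings F"
begin

lemma emb_add: "x \<in> F \<Longrightarrow> y \<in> F \<Longrightarrow> \<sigma> (x + y) = \<sigma> x + \<sigma> y"
  and emb_mult: "x \<in> F \<Longrightarrow> y \<in> F \<Longrightarrow> \<sigma> (x * y) = \<sigma> x * \<sigma> y"
  and emb_one: "\<sigma> 1 = 1"
  and emb_outside: "x \<notin> F \<Longrightarrow> \<sigma> x = 0"
  using \<sigma> by (auto simp: embeddings_def)

lemma emb_zero: "\<sigma> 0 = 0"
  using emb_add[of 0 0] by simp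

lemma emb_uminus: "x \<in> F \<Longrightarrow> \<sigma> (- x) = - \<sigma> x"
  using emb_add[of x "- x"] emb_zero by (simp add: uminus_in add_eq_0_iff)

lemma emb_diff: "x \<in> F \<Longrightarrow> y \<in> F \<Longrightarrow> \<sigma> (x - y) = \<sigma> x - \<sigma> y"
  using emb_add[of x "- y"] by (simp add: uminus_in emb_uminus)

lemma emb_eq_0_iff: "x \<in> F \<Longrightarrow> \<sigma> x = 0 \<longleftrightarrow> x = 0"
  using emb_mult[of x "inverse x"] emb_one emb_zero by (cases "x = 0") (auto simp: inverse_in)

lemma emb_inverse: "x \<in> F \<Longrightarrow> \<sigma> (inverse x) = inverse (\<sigma> x)"
  using emb_mult[of x "inverse x"] emb_one emb_zero
  by (cases "x = 0") (auto simp: inverse_in inverse_unique)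

lemma emb_divide: "x \<in> F \<Longrightarrow> y \<in> F \<Longrightarrow> \<sigma> (x / y) = \<sigma> x / \<sigma> y"
  by (simp add: divide_inverse emb_mult emb_inverse inverse_in)

lemma emb_eq_iff: "x \<in> F \<Longrightarrow> y \<in> F \<Longrightarrow> \<sigma> x = \<sigma> y \<longleftrightarrow> x = y"
  using emb_eq_0_iff[of "x - y"] by (simp add: emb_diff diff_in)

lemma emb_power: "x \<in> F \<Longrightarrow> \<sigma> (x ^ k) = \<sigma> x ^ k"
  by (induction k) (auto simp: emb_one emb_mult power_in)

lemma emb_powi: "x \<in> F \<Longrightarrow> \<sigma> (x powi k) = \<sigma> x powi k"
  by (auto simp: power_int_def emb_power emb_inverse inverse_in power_in)

lemma emb_sum: "(\<And>i. i \<in> I \<Longrightarrow> f i \<in> F) \<Longrightarrow> \<sigma> (\<Sum>i\<in>I. f i) = (\<Sum>i\<in>I. \<sigma> (f i))"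
  by (induction I rule: infinite_finite_induct) (auto simp: emb_zero emb_add sum_in)

lemma emb_prod: "(\<And>i. i \<in> I \<Longrightarrow> f i \<in> F) \<Longrightarrow> \<sigma> (\<Prod>i\<in>I. f i) = (\<Prod>i\<in>I. \<sigma> (f i))"
  by (induction I rule: infinite_finite_induct) (auto simp: emb_one emb_mult prod_in)

lemma emb_of_nat: "\<sigma> (of_nat k) = of_nat k"
  by (induction k) (auto simp: emb_zero emb_one emb_add)

lemma emb_of_int: "\<sigma> (of_int k) = of_int k"
  by (cases k) (auto simp: emb_of_nat emb_uminus simp del: of_nat_Suc)

lemma emb_Rats: "x \<in> \<rat> \<Longrightarrow> \<sigma> x = x"
  by (auto elim!: Rats_cases' simp: emb_divide emb_of_int)

lemma emb_of_rat: "\<sigma> (of_rat q) = of_rat q"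
  by (rule emb_Rats) simp

lemma emb_poly: "x \<in> F \<Longrightarrow> \<sigma> (poly (map_poly of_rat p) x) = poly (map_poly of_rat p) (\<sigma> x)"
  by (simp add: poly_altdef emb_sum mult_in power_in emb_mult emb_of_rat emb_power)

lemma emb_algebraic_integer:
  assumes "algebraic_integer x" "x \<in> F"
  shows "algebraic_integer (\<sigma> x)"
proof -
  obtain p :: "int poly" where p: "lead_coeff p = 1" "poly (map_poly of_int p) x = 0"
    using assms by (auto simp: algebraic_integer_def)
  have "poly (map_poly of_int p) (\<sigma> x) = \<sigma> (poly (map_poly of_int p) x)"
    using assms(2) by (simp add: poly_altdef emb_sum mult_in power_in emb_mult emb_of_int emb_power)
  then show ?thesis using p emb_zero by (auto simp: algebraic_integer_def)
qed

lemma emb_cnj: "cnj \<circ> \<sigma> \<in> embeddings F"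
  using \<sigma> by (auto simp: embeddings_def)

end

lemma emb_eqI: "\<sigma> \<in> embeddings F \<Longrightarrow> \<rho> \<in> embeddings F \<Longrightarrow> (\<And>x. x \<in> F \<Longrightarrow> \<sigma> x = \<rho> x) \<Longrightarrow> \<sigma> = \<rho>"
  using emb_outside by (metis ext)

lemma id_embedding: "(\<lambda>x. if x \<in> F then x else 0) \<in> embeddings F"
  by (auto simp: embeddings_def)

text \<open>Artin's argument for characters: the relation at \<open>x * y\<close> minus
  \<open>\<rho> y\<close> times the relation at \<open>x\<close> no longer contains
  \<open>\<rho>\<close>, while the coefficient of \<open>\<sigma>\<close> is multiplied by
  \<open>\<sigma> y - \<rho> y\<close>, which is nonzero for a suitable \<open>y\<close>.\<close>

lemma embeddings_independent:
  assumes "finite S" "S \<subseteq> embeddings F" "\<And>x. x \<in> F \<Longrightarrow> (\<Sum>\<sigma>\<in>S. c \<sigma> * \<sigma> x) = 0" "\<sigma> \<in> S"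
  shows "c \<sigma> = 0"
  using assms
proof (induction S arbitrary: c \<sigma> rule: finite_induct)
  case empty
  then show ?case by simp
next
  case (insert \<rho> S)
  have \<rho>: "\<rho> \<in> embeddings F" and S: "S \<subseteq> embeddings F" using insert.prems by auto
  have tail: "c \<sigma> = 0" if \<sigma>: "\<sigma> \<in> S" for \<sigma>
  proof -
    have "\<sigma> \<noteq> \<rho>" using \<sigma> insert.hyps by auto
    then obtain y where y: "y \<in> F" "\<sigma> y \<noteq> \<rho> y"
      using emb_eqI[of \<sigma> \<rho>] \<sigma> S \<rho> by auto
    have "(\<Sum>\<sigma>\<in>S. (c \<sigma> * (\<sigma> y - \<rho> y)) * \<sigma> x) = 0" if x: "x \<in> F" for x
    proof -
      have "(\<Sum>\<sigma>\<in>S. (c \<sigma> * (\<sigma> y - \<rho> y)) * \<sigma> x)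
          = (\<Sum>\<sigma>\<in>S. c \<sigma> * \<sigma> (x * y)) - \<rho> y * (\<Sum>\<sigma>\<in>S. c \<sigma> * \<sigma> x)"
        unfolding sum_distrib_left sum_subtractf[symmetric]
        using S x y(1) by (intro sum.cong refl) (auto simp: emb_mult algebra_simps)
      also have "\<dots> = - (c \<rho> * \<rho> (x * y)) + \<rho> y * (c \<rho> * \<rho> x)"
        using insert.prems(2)[of "x * y"] insert.prems(2)[OF x] insert.hyps x y(1)
        by (auto simp: mult_in add_eq_0_iff)
      also have "\<dots> = 0" using x y(1) \<rho> by (simp add: emb_mult)
      finally show ?thesis .
    qed
    then have "c \<sigma> * (\<sigma> y - \<rho> y) = 0" using insert.IH[OF S, of "\<lambda>\<sigma>. c \<sigma> * (\<sigma> y - \<rho> y)"] \<sigma> by blast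
    then show ?thesis using y by simp
  qed
  have "(\<Sum>\<sigma>\<in>insert \<rho> S. c \<sigma> * \<sigma> 1) = c \<rho>"
    using insert.hyps tail by (simp add: emb_one[OF \<rho>])
  then have "c \<rho> = 0" using insert.prems(2)[of 1] by simp
  then show ?case using tail insert.prems(3) by auto
qed

end

text \<open>The basis is kept in the coordinate form of \<open>field_degree\<close>. The number of
  embeddings is an assumption here; in the theorem it is the sum of the given numbers of real and
  nonreal embeddings.\<close>

locale number_field_basis = subfield_of_complex +
  fixes n :: nat and b :: "nat \<Rightarrow> complex"
  assumes basis_in: "\<And>i. i < n \<Longrightarrow> b i \<in> F"
    and basis_ex1: "\<And>x. x \<in> F \<Longrightarrow> \<exists>!c :: nat \<Rightarrow> complex. (\<forall>i<n. c i \<in> \<rat>) \<and> (\<forall>i\<ge>n. c i = 0) \<and>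
                    x = (\<Sum>i<n. c i * b i)"
    and card_embeddings: "card (embeddings F) = n"
    and n_pos: "n > 0"
begin

abbreviation "E \<equiv> embeddings F"

lemma finite_embeddings [simp, intro]: "finite E"
  using card_embeddings n_pos card_gt_0_iff by metis

lemma ex_coordinates:
  assumes "x \<in> F"
  obtains c :: "nat \<Rightarrow> rat" where "x = (\<Sum>i<n. of_rat (c i) * b i)"
proof -
  obtain c where c: "\<forall>i<n. c i \<in> \<rat>" "x = (\<Sum>i<n. c i * b i)"
    using basis_ex1[OF assms] ex1_implies_ex by metis
  then have "\<exists>q. i < n \<longrightarrow> c i = of_rat q" for i
    using Rats_cases[of "c i"] by metis
  then obtain q where "\<And>i. i < n \<Longrightarrow> c i = of_rat (q i)" by metis
  then show thesis using that[of q] c(2) by simp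
qed

lemma emb_combination:
  "\<sigma> \<in> E \<Longrightarrow> \<sigma> (\<Sum>i<n. of_rat (c i) * b i) = (\<Sum>i<n. of_rat (c i) * \<sigma> (b i))"
  using basis_in by (subst emb_sum) (auto simp: emb_mult[of \<sigma>] emb_of_rat[of \<sigma>])

lemma coordinates_unique:
  assumes "(\<Sum>i<n. of_rat (c i) * b i) = (\<Sum>i<n. of_rat (d i) * b i)" "i < n"
  shows "c i = (d i :: rat)"
proof -
  let ?c = "\<lambda>i. if i < n then of_rat (c i) else 0 :: complex"
  let ?d = "\<lambda>i. if i < n then of_rat (d i) else 0 :: complex"
  let ?x = "\<Sum>i<n. of_rat (c i) * b i"
  have x: "?x \<in> F" using basis_in by (auto intro!: sum_in mult_in)
  obtain c0 where c0: "\<And>c. (\<forall>i<n. c i \<in> \<rat>) \<and> (\<forall>i\<ge>n. c i = 0) \<and> ?x = (\<Sum>i<n. c i * b i) \<Longrightarrow> c = c0"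
    by (rule ex1E[OF basis_ex1[OF x]]) blast
  have "?c = c0" by (rule c0) simp
  moreover have "?d = c0" by (rule c0) (simp add: assms(1))
  ultimately have "?c = ?d" by simp
  then have "?c i = ?d i" by metis
  then show ?thesis using assms(2) by simp
qed

text \<open>The matrix \<open>A\<close> of multiplication by \<open>x\<close> is rational, and the conjugates of the basis form an
  invertible matrix \<open>V\<close> with \<open>A V = V D\<close>, \<open>D\<close> being diagonal with entries \<open>\<sigma> x\<close>.\<close>

lemma ex_characteristic_polynomial:
  assumes x: "x \<in> F"
  obtains p :: "rat poly" where "map_poly of_rat p = (\<Prod>\<sigma>\<in>E. [:- \<sigma> x, 1:])"
proof -
  obtain h where h: "bij_betw h {..<n} E"
    using ex_bij_betw_nat_finite[OF finite_embeddings] card_embeddings by (auto simp: atLeast0LessThan)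
  have hE: "h j \<in> E" if "j < n" for j using h that by (auto simp: bij_betw_def)
  have "\<forall>k. \<exists>c. k < n \<longrightarrow> x * b k = (\<Sum>i<n. of_rat (c i) * b i)"
    using ex_coordinates[of "x * b _"] basis_in x mult_in by metis
  then obtain a :: "nat \<Rightarrow> nat \<Rightarrow> rat" where a: "\<And>k. k < n \<Longrightarrow> x * b k = (\<Sum>i<n. of_rat (a k i) * b i)"
    by metis
  define A where "A = mat n n (\<lambda>(i, j). a i j)"
  define AC where "AC = (map_mat of_rat A :: complex mat)"
  define V where "V = mat n n (\<lambda>(k, j). h j (b k))"
  define D where "D = mat n n (\<lambda>(i, j). if i = j then h j x else 0)"
  have car: "A \<in> carrier_mat n n" "AC \<in> carrier_mat n n" "V \<in> carrier_mat n n" "D \<in> carrier_mat n n"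
    by (auto simp: A_def AC_def V_def D_def)
  have AV: "AC * V = V * D"
  proof (rule eq_matI)
    fix k j assume "k < dim_row (V * D)" "j < dim_col (V * D)"
    then have k: "k < n" and j: "j < n" using car by auto
    have "(AC * V) $$ (k, j) = (\<Sum>i<n. of_rat (a k i) * h j (b i))"
      using k j by (simp add: AC_def A_def V_def scalar_prod_def lessThan_atLeast0)
    also have "\<dots> = h j (\<Sum>i<n. of_rat (a k i) * b i)"
      using hE[OF j] by (simp add: emb_combination)
    also have "\<dots> = h j (b k) * h j x"
      unfolding a[OF k, symmetric] using basis_in[OF k] x hE[OF j] by (simp add: emb_mult)
    also have "\<dots> = (V * D) $$ (k, j)"
      using k j by (simp add: D_def V_def scalar_prod_def if_distrib cong: if_cong)
    finally show "(AC * V) $$ (k, j) = (V * D) $$ (k, j)" .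
  qed (use car in auto)
  \<comment> \<open>A kernel vector of \<open>V\<close> is a linear relation between the embeddings
    on the basis. By rationality of the coordinates it extends to all of \<open>F\<close>, against
    the independence of the embeddings.\<close>
  have "Determinant.det V \<noteq> 0"
  proof
    assume "Determinant.det V = 0"
    then obtain v where v: "v \<in> carrier_vec n" "v \<noteq> 0\<^sub>v n" "V *\<^sub>v v = 0\<^sub>v n"
      using det_0_iff_vec_prod_zero[OF car(3)] by auto
    define c where "c = (\<lambda>\<sigma>. vec_index v (inv_into {..<n} h \<sigma>))"
    have c: "c (h j) = vec_index v j" if "j < n" for j
      using h that by (simp add: c_def bij_betw_def inv_into_f_f)
    have rel: "(\<Sum>\<sigma>\<in>E. c \<sigma> * \<sigma> (b k)) = 0" if k: "k < n" for k
    proof -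
      have "(\<Sum>\<sigma>\<in>E. c \<sigma> * \<sigma> (b k)) = (\<Sum>j<n. c (h j) * h j (b k))"
        by (rule sum.reindex_bij_betw[OF h, symmetric])
      also have "\<dots> = vec_index (V *\<^sub>v v) k"
        using k v(1) by (auto simp: V_def scalar_prod_def lessThan_atLeast0 c mult.commute intro!: sum.cong)
      finally show ?thesis using v(3) k by simp
    qed
    have "(\<Sum>\<sigma>\<in>E. c \<sigma> * \<sigma> y) = 0" if y: "y \<in> F" for y
    proof -
      obtain q :: "nat \<Rightarrow> rat" where q: "y = (\<Sum>i<n. of_rat (q i) * b i)" using ex_coordinates[OF y] .
      have "(\<Sum>\<sigma>\<in>E. c \<sigma> * \<sigma> y) = (\<Sum>\<sigma>\<in>E. \<Sum>i<n. of_rat (q i) * (c \<sigma> * \<sigma> (b i)))"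
      proof (intro sum.cong refl)
        fix \<sigma> assume "\<sigma> \<in> E"
        then have "\<sigma> y = (\<Sum>i<n. of_rat (q i) * \<sigma> (b i))"
          unfolding q by (rule emb_combination)
        then show "c \<sigma> * \<sigma> y = (\<Sum>i<n. of_rat (q i) * (c \<sigma> * \<sigma> (b i)))"
          by (simp add: sum_distrib_left algebra_simps)
      qed
      also have "\<dots> = (\<Sum>i<n. of_rat (q i) * (\<Sum>\<sigma>\<in>E. c \<sigma> * \<sigma> (b i)))"
        by (subst sum.swap) (simp add: sum_distrib_left)
      finally show ?thesis using rel by simp
    qed
    then have "c \<sigma> = 0" if "\<sigma> \<in> E" for \<sigma>
      using embeddings_independent[of E c] that by blast
    then have "vec_index v j = 0" if "j < n" for j using c[OF that] hE[OF that] by metis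
    then have "v = 0\<^sub>v n" using v(1) by (intro eq_vecI) auto
    then show False using v(2) by simp
  qed
  then obtain W where W: "W \<in> carrier_mat n n" "W * V = 1\<^sub>m n"
    using det_non_zero_imp_unit[OF car(3), of "()"] by (auto simp: Units_def ring_mat_def)
  then have VW: "V * W = 1\<^sub>m n" using mat_mult_left_right_inverse car(3) by blast
  have "AC = AC * (V * W)" using car VW by simp
  also have "\<dots> = V * D * W" using AV assoc_mult_mat[OF car(2,3) W(1)] by simp
  finally have "similar_mat_wit AC D V W"
    using car W VW unfolding similar_mat_wit_def by (auto simp: Let_def)
  then have "char_poly AC = char_poly D" by (intro char_poly_similar) (auto simp: similar_mat_def)
  also have "\<dots> = (\<Prod>a\<leftarrow>diag_mat D. [:- a, 1:])"
    by (rule char_poly_upper_triangular[OF car(4)]) (auto simp: D_def upper_triangular_def)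
  also have "diag_mat D = map (\<lambda>j. h j x) [0..<n]"
    by (auto simp: diag_mat_def D_def)
  also have "(\<Prod>a\<leftarrow>map (\<lambda>j. h j x) [0..<n]. [:- a, 1:]) = (\<Prod>j<n. [:- h j x, 1:])"
    by (simp add: prod.distinct_set_conv_list[symmetric] atLeast0LessThan[symmetric] o_def
        flip: prod.list_conv_set_nth)
  also have "\<dots> = (\<Prod>\<sigma>\<in>E. [:- \<sigma> x, 1:])"
    by (rule prod.reindex_bij_betw[OF h])
  also have "char_poly AC = map_poly of_rat (char_poly A)"
    unfolding AC_def by (rule of_rat_hom.char_poly_hom[OF car(1)])
  finally show thesis using that by blast
qed

lemma prod_embeddings_Rats:
  assumes "x \<in> F"
  shows "(\<Prod>\<sigma>\<in>E. \<sigma> x) \<in> \<rat>"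
proof -
  \<comment> \<open>The constant term is wanted. Taking the polynomial of \<open>- x\<close> makes
    its factors at 0 equal to \<open>\<sigma> x\<close>, so no sign \<open>(-1) ^ n\<close>
    appears.\<close>
  obtain p :: "rat poly" where p: "map_poly of_rat p = (\<Prod>\<sigma>\<in>E. [:- \<sigma> (- x), 1:])"
    using ex_characteristic_polynomial[of "- x"] assms by auto
  have "(\<Prod>\<sigma>\<in>E. \<sigma> x) = poly (map_poly of_rat p) 0"
    unfolding p poly_prod using assms by (intro prod.cong) (auto simp: emb_uminus)
  also have "\<dots> = of_rat (poly p 0)" by (simp add: poly_0_coeff_0)
  finally show ?thesis by simp
qed

section \<open>The norm over the rationals\<close>

definition norm_of :: "complex \<Rightarrow> complex" where
  "norm_of x = (\<Prod>\<sigma>\<in>E. \<sigma> x)"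

lemma norm_of_int:
  assumes "x \<in> ring_of_integers F"
  shows "norm_of x \<in> \<int>"
proof (rule rational_algebraic_integer)
  show "algebraic_integer (norm_of x)"
    unfolding norm_of_def
  proof (rule algebraic_integer_prod)
    fix \<sigma> assume "\<sigma> \<in> E"
    then show "algebraic_integer (\<sigma> x)"
      using assms by (intro emb_algebraic_integer[of \<sigma> x]) (simp_all add: ring_of_integers_def)
  qed
  show "norm_of x \<in> \<rat>"
    using assms prod_embeddings_Rats by (auto simp: norm_of_def ring_of_integers_def)
qed

lemma norm_of_eq_0_iff: "x \<in> F \<Longrightarrow> norm_of x = 0 \<longleftrightarrow> x = 0"
proof -
  assume x: "x \<in> F"
  have "E \<noteq> {}" using card_embeddings n_pos by auto
  then show ?thesis using x by (auto simp: norm_of_def emb_eq_0_iff emb_zero)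
qed

text \<open>The norm is a nonzero rational integer. This is the only source of discreteness in what
  follows.\<close>

lemma cmod_norm_ge_1:
  assumes "x \<in> ring_of_integers F" "x \<noteq> 0"
  shows "1 \<le> (\<Prod>\<sigma>\<in>E. cmod (\<sigma> x))"
proof -
  obtain k where k: "norm_of x = of_int k" using norm_of_int[OF assms(1)] by (auto elim: Ints_cases)
  have "x \<in> F" using assms by (simp add: ring_of_integers_def)
  then have "k \<noteq> 0" using norm_of_eq_0_iff[of x] k assms(2) by auto
  then have "1 \<le> cmod (norm_of x)" using k by simp
  then show ?thesis by (simp add: norm_of_def prod_norm)
qed

text \<open>The identity, cut off to 0 outside \<open>F\<close>, is one of the embeddings, so
  \<open>x\<close> is a factor of its own norm and the cofactor is a product of conjugates of
  \<open>x\<close>.\<close>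

lemma norm_dvd:
  assumes "x \<in> ring_of_integers F" "x \<noteq> 0"
  shows "algebraic_integer (norm_of x / x)"
proof -
  define i where "i = (\<lambda>y. if y \<in> F then y else 0)"
  have i: "i \<in> E" using id_embedding by (simp add: i_def)
  have x: "x \<in> F" "algebraic_integer x" using assms by (auto simp: ring_of_integers_def)
  have "norm_of x = x * (\<Prod>\<sigma>\<in>E - {i}. \<sigma> x)"
    using i x by (simp add: norm_of_def prod.remove[where x=i] i_def)
  then have "norm_of x / x = (\<Prod>\<sigma>\<in>E - {i}. \<sigma> x)" using assms(2) by simp
  moreover have "algebraic_integer (\<Prod>\<sigma>\<in>E - {i}. \<sigma> x)"
  proof (rule algebraic_integer_prod)
    fix \<sigma> assume "\<sigma> \<in> E - {i}"
    then show "algebraic_integer (\<sigma> x)"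
      using x by (intro emb_algebraic_integer[of \<sigma> x]) simp_all
  qed
  ultimately show ?thesis by simp
qed

end

section \<open>Integers of small absolute value\<close>

context subfield_of_complex
begin

abbreviation "OI \<equiv> ring_of_integers F"

lemma OI_in: "x \<in> OI \<Longrightarrow> x \<in> F" and OI_integer: "x \<in> OI \<Longrightarrow> algebraic_integer x"
  by (simp_all add: ring_of_integers_def)

lemma OI_add: "x \<in> OI \<Longrightarrow> y \<in> OI \<Longrightarrow> x + y \<in> OI"
  and OI_mult: "x \<in> OI \<Longrightarrow> y \<in> OI \<Longrightarrow> x * y \<in> OI"
  and OI_uminus: "x \<in> OI \<Longrightarrow> - x \<in> OI"
  and OI_of_int: "of_int k \<in> OI"
  by (auto simp: ring_of_integers_def algebraic_integer_add algebraic_integer_mult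
      algebraic_integer_uminus algebraic_integer_of_int)

lemma OI_one: "1 \<in> OI"
  using OI_of_int[of 1] by simp

lemma OI_diff: "x \<in> OI \<Longrightarrow> y \<in> OI \<Longrightarrow> x - y \<in> OI"
  using OI_add[of x "- y"] OI_uminus[of y] by simp

lemma OI_power: "x \<in> OI \<Longrightarrow> x ^ k \<in> OI"
  by (induction k) (auto simp: OI_one OI_mult)

lemma OI_sum: "(\<And>i. i \<in> I \<Longrightarrow> f i \<in> OI) \<Longrightarrow> (\<Sum>i\<in>I. f i) \<in> OI"
  using OI_of_int[of 0] by (induction I rule: infinite_finite_induct) (auto simp: OI_add)

end

lemma ex_common_denominator:
  assumes "finite (Q :: rat set)"
  shows "\<exists>d>0. \<forall>q\<in>Q. of_int d * q \<in> \<int>"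
  using assms
proof (induction Q rule: finite_induct)
  case empty
  show ?case by (rule exI[of _ 1]) simp
next
  case (insert q Q)
  then obtain d :: int where d: "d > 0" "\<And>r. r \<in> Q \<Longrightarrow> of_int d * r \<in> \<int>" by auto
  obtain p k where q: "k > 0" "q = of_int p / of_int k"
    by (metis Fract_of_int_quotient Rat_cases)
  show ?case
  proof (intro exI[of _ "d * k"] conjI ballI)
    fix r assume "r \<in> insert q Q"
    then show "of_int (d * k) * r \<in> \<int>"
    proof
      assume "r = q"
      then have "of_int (d * k) * r = of_int (d * p)" using q by simp
      then show ?thesis by (metis Ints_of_int)
    next
      assume "r \<in> Q"
      then have "of_int k * (of_int d * r) \<in> \<int>" by (intro Ints_mult Ints_of_int d(2))
      then show ?thesis by (simp add: mult_ac)
    qed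
  qed (use d q in auto)
qed

context number_field_basis
begin

lemma combination_eq_0:
  assumes "(\<Sum>i<n. of_rat (c i) * b i) = 0" "i < n"
  shows "c i = (0 :: rat)"
  using coordinates_unique[of c "\<lambda>_. 0" i] assms by simp

lemma basis_nonzero:
  assumes "i < n"
  shows "b i \<noteq> 0"
proof
  assume "b i = 0"
  then have "(\<Sum>k<n. of_rat (if k = i then 1 else 0) * b k) = 0"
    by (intro sum.neutral) auto
  then show False using combination_eq_0[of "\<lambda>k. if k = i then 1 else 0" i] assms by simp
qed

text \<open>Multiplication by \<open>x\<close> has a rational matrix in the basis \<open>b\<close>.
  With \<open>d\<close> a common denominator of its entries, \<open>d * x\<close> is an eigenvalue
  of an integer matrix.\<close>

lemma ex_integral_multiple:
  assumes x: "x \<in> F"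
  obtains d :: int where "d > 0" "of_int d * x \<in> OI"
proof -
  have "\<exists>c. k < n \<longrightarrow> x * b k = (\<Sum>i<n. of_rat (c i) * b i)" for k
    using ex_coordinates[of "x * b k"] basis_in[of k] x mult_in by metis
  then obtain a :: "nat \<Rightarrow> nat \<Rightarrow> rat" where a: "\<And>k. k < n \<Longrightarrow> x * b k = (\<Sum>i<n. of_rat (a k i) * b i)"
    by metis
  define Q where "Q = (\<lambda>(k, i). a k i) ` ({..<n} \<times> {..<n})"
  have "finite Q" by (simp add: Q_def)
  from ex_common_denominator[OF this] obtain d :: int
    where d: "d > 0" "\<And>q. q \<in> Q \<Longrightarrow> of_int d * q \<in> \<int>" by blast
  have "\<exists>z. k < n \<longrightarrow> i < n \<longrightarrow> of_int d * a k i = of_int z" for k i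
  proof (cases "k < n \<and> i < n")
    case True
    then have "a k i \<in> Q" unfolding Q_def by (intro image_eqI[of _ _ "(k, i)"]) auto
    from d(2)[OF this] show ?thesis by (auto elim: Ints_cases)
  qed auto
  then obtain z where z: "\<And>k i. k < n \<Longrightarrow> i < n \<Longrightarrow> of_int d * a k i = of_int (z k i)" by metis
  have "algebraic_integer (of_int d * x)"
  proof (rule algebraic_integer_eigenvalue[where v=b and m=n and A=z and ?k0.0=0])
    fix k assume k: "k < n"
    have "of_int d * x * b k = of_int d * (\<Sum>i<n. of_rat (a k i) * b i)" using a[OF k] by simp
    also have "\<dots> = (\<Sum>i<n. of_rat (of_int d * a k i) * b i)"
      by (simp add: sum_distrib_left of_rat_mult mult.assoc)
    also have "\<dots> = (\<Sum>i<n. of_int (z k i) * b i)" using z[OF k] by simp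
    finally show "of_int d * x * b k = (\<Sum>i<n. of_int (z k i) * b i)" .
  qed (use n_pos basis_nonzero in auto)
  then show thesis using that d(1) x by (auto simp: ring_of_integers_def)
qed

text \<open>The basis \<open>b\<close> with denominators cleared. The integral combinations of
  \<open>w\<close> form a sublattice of full rank of the ring of integers, possibly a proper
  one.\<close>

lemma ex_integral_basis:
  obtains w :: "nat \<Rightarrow> complex" where "\<And>i. i < n \<Longrightarrow> w i \<in> OI"
    "\<And>c :: nat \<Rightarrow> int. (\<Sum>i<n. of_int (c i) * w i) = 0 \<Longrightarrow> \<forall>i<n. c i = 0"
proof -
  have "\<exists>d::int. i < n \<longrightarrow> d > 0 \<and> of_int d * b i \<in> OI" for i
    using ex_integral_multiple[of "b i"] basis_in[of i] by metis
  then obtain d :: "nat \<Rightarrow> int" where d: "\<And>i. i < n \<Longrightarrow> d i > 0" "\<And>i. i < n \<Longrightarrow> of_int (d i) * b i \<in> OI"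
    by metis
  show thesis
  proof (rule that[of "\<lambda>i. of_int (d i) * b i"])
    fix c :: "nat \<Rightarrow> int"
    assume c: "(\<Sum>i<n. of_int (c i) * (of_int (d i) * b i)) = 0"
    have "(\<Sum>i<n. of_rat (of_int (c i * d i)) * b i) = 0"
      using c by (simp add: of_rat_mult mult.assoc)
    then have "c i * d i = 0" if "i < n" for i
      using combination_eq_0[OF _ that, of "\<lambda>i. of_int (c i * d i)"] by simp
    then show "\<forall>i<n. c i = 0" using d(1) by fastforce
  qed (use d in auto)
qed

text \<open>\<open>a / c = 1 + y * (D / N) * (N / c)\<close>, where \<open>D / N\<close> is an
  integer and \<open>N / c\<close> is integral because \<open>N\<close> is the norm of
  \<open>c\<close>.\<close>

lemma quotient_integral:
  assumes a: "a \<in> OI" and c: "c \<in> OI" "c \<noteq> 0" and y: "y \<in> OI"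
    and eq: "a - c = of_int D * y" and N: "norm_of c = of_int N" "N dvd D"
  shows "a / c \<in> OI"
proof -
  obtain k where k: "D = N * k" using N by auto
  have q: "norm_of c / c \<in> OI"
    using norm_dvd[OF c] c(1) OI_in[OF c(1)] N(1) by (auto simp: ring_of_integers_def)
  have "a / c = 1 + y * (of_int k * (norm_of c / c))"
    using eq c(2) by (simp add: k N field_simps)
  also have "\<dots> \<in> OI" using q y by (intro OI_add OI_mult OI_one OI_of_int)
  finally show ?thesis .
qed

end

section \<open>Fields with one pair of nonreal embeddings\<close>

locale OT_field = number_field_basis +
  fixes \<tau> :: "complex \<Rightarrow> complex"
  assumes n_gt_2: "n > 2"
    and card_real: "card (real_embeddings F) = n - 2"
    and card_nonreal: "card (nonreal_embeddings F) = 2"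
    and \<tau>: "\<tau> \<in> nonreal_embeddings F"
begin

abbreviation "R \<equiv> real_embeddings F"
abbreviation "\<tau>' \<equiv> cnj \<circ> \<tau>"

lemma \<tau>_E: "\<tau> \<in> E" and \<tau>'_E: "\<tau>' \<in> E"
  using \<tau> emb_cnj[of \<tau>] by (auto simp: nonreal_embeddings_def)

lemma ex_nonreal:
  obtains x where "x \<in> F" "\<tau> x \<notin> \<real>"
  using \<tau> by (auto simp: nonreal_embeddings_def real_embeddings_def)

lemma \<tau>'_neq: "\<tau>' \<noteq> \<tau>"
proof
  assume "\<tau>' = \<tau>"
  then have "cnj (\<tau> x) = \<tau> x" for x by (metis comp_apply)
  then show False using ex_nonreal Reals_cnj_iff by metis
qed

lemma nonreal_eq: "nonreal_embeddings F = {\<tau>, \<tau>'}"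
proof (rule card_subset_eq[symmetric])
  obtain x where x: "x \<in> F" "\<tau> x \<notin> \<real>" by (rule ex_nonreal)
  then have "\<tau>' x \<notin> \<real>" using Reals_cnj_iff by (metis comp_apply complex_cnj_cnj)
  then have "\<tau>' \<in> nonreal_embeddings F"
    using x \<tau>'_E by (auto simp: nonreal_embeddings_def real_embeddings_def)
  then show "{\<tau>, \<tau>'} \<subseteq> nonreal_embeddings F" using \<tau> by simp
  show "card {\<tau>, \<tau>'} = card (nonreal_embeddings F)"
    using \<tau>'_neq card_nonreal by (simp add: card_insert_if eq_commute)
  show "finite (nonreal_embeddings F)" using card_nonreal card_gt_0_iff by fastforce
qed

lemma R_subset: "R \<subseteq> E"
  by (auto simp: real_embeddings_def)

lemma finite_R [simp, intro]: "finite R"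
  using finite_subset[OF R_subset] by simp

lemma R_nonempty: "R \<noteq> {}"
  using card_real n_gt_2 by auto

lemma E_eq: "E = insert \<tau> (insert \<tau>' R)" and \<tau>_notin: "\<tau> \<notin> R" and \<tau>'_notin: "\<tau>' \<notin> R"
  using nonreal_eq R_subset by (auto simp: nonreal_embeddings_def)

lemma real_val: "\<sigma> \<in> R \<Longrightarrow> \<sigma> x \<in> \<real>"
  using emb_outside[of \<sigma> x] by (cases "x \<in> F") (auto simp: real_embeddings_def)

lemma real_cmod: "\<sigma> \<in> R \<Longrightarrow> cmod (\<sigma> x) = \<bar>Re (\<sigma> x)\<bar>"
  by (metis real_val in_Reals_norm)

lemma prod_E: "(\<Prod>\<sigma>\<in>E. f \<sigma>) = f \<tau> * f \<tau>' * (\<Prod>\<sigma>\<in>R. f \<sigma>)" for f :: "_ \<Rightarrow> 'a :: comm_monoid_mult"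
  using \<tau>_notin \<tau>'_notin \<tau>'_neq by (subst E_eq) (simp add: mult.assoc)

lemma prod_cmod_E: "(\<Prod>\<sigma>\<in>E. cmod (\<sigma> x)) = (cmod (\<tau> x))\<^sup>2 * (\<Prod>\<sigma>\<in>R. cmod (\<sigma> x))"
  by (simp add: prod_E power2_eq_square)

text \<open>A Minkowski-type bound obtained from the pigeonhole principle: the \<open>(t ^ (n - 1) + 1) ^ n\<close> integral
  combinations with coefficients up to \<open>t ^ (n - 1)\<close> are distributed over at most \<open>(t ^ n) ^ (n - 1)\<close>
  boxes according to their \<open>n - 1\<close> real coordinates away from \<open>\<rho>\<close>.\<close>

lemma ex_small_combination:
  fixes w :: "nat \<Rightarrow> complex" and M :: real
  assumes \<rho>: "\<rho> \<in> R" and w: "\<And>k. k < n \<Longrightarrow> w k \<in> F"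
    and M: "M \<ge> 1" "\<And>\<sigma>. \<sigma> \<in> E \<Longrightarrow> (\<Sum>k<n. cmod (\<sigma> (w k))) \<le> M"
    and t: "(t::nat) \<ge> 6"
  obtains e :: "nat \<Rightarrow> int" where "\<exists>k<n. e k \<noteq> 0"
    "\<And>\<sigma>. \<sigma> \<in> E \<Longrightarrow> \<sigma> \<noteq> \<rho> \<Longrightarrow> cmod (\<sigma> (\<Sum>k<n. of_int (e k) * w k)) \<le> 6 * M / t"
    "cmod (\<rho> (\<Sum>k<n. of_int (e k) * w k)) \<le> M * real t ^ (n - 1)"
proof -
  define H where "H = t ^ (n - 1)"
  define T where "T = t ^ n"
  define X where "X = (\<lambda>c :: nat \<Rightarrow> int. \<Sum>k<n. of_int (c k) * w k)"
  \<comment> \<open>Each embedding is to supply one real coordinate. The conjugate pair shares the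
    two coordinates of \<open>\<tau>\<close>: the real part is read at \<open>\<tau>\<close>, the
    imaginary part at \<open>\<tau>'\<close>. Leaving out \<open>\<rho>\<close> then leaves
    \<open>n - 1\<close> coordinates.\<close>
  define part where "part = (\<lambda>\<sigma> z. if \<sigma> = \<tau>' then Im z else Re z)"
  have part_le: "\<bar>part \<sigma> z\<bar> \<le> cmod z" for \<sigma> z
    by (simp add: part_def abs_Re_le_cmod abs_Im_le_cmod)
  have part_diff: "part \<sigma> (y - z) = part \<sigma> y - part \<sigma> z" for \<sigma> y z by (simp add: part_def)
  have XF: "X c \<in> F" for c using w by (auto simp: X_def intro!: sum_in mult_in)
  have X_bound: "cmod (\<sigma> (X c)) \<le> M * real H" if "\<sigma> \<in> E" "\<And>k. k < n \<Longrightarrow> \<bar>c k\<bar> \<le> int H" for \<sigma> c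
  proof -
    have "\<sigma> (X c) = (\<Sum>k<n. \<sigma> (of_int (c k) * w k))"
      unfolding X_def using w by (intro emb_sum[OF that(1)]) (auto intro: mult_in)
    also have "\<dots> = (\<Sum>k<n. of_int (c k) * \<sigma> (w k))"
      using w by (intro sum.cong) (auto simp: emb_mult[OF that(1)] emb_of_int[OF that(1)])
    also have "cmod \<dots> \<le> (\<Sum>k<n. real H * cmod (\<sigma> (w k)))"
    proof (rule sum_norm_le)
      fix k assume "k \<in> {..<n}"
      then have "\<bar>c k\<bar> \<le> int H" using that(2) by simp
      then have "\<bar>real_of_int (c k)\<bar> \<le> real H" by linarith
      then show "cmod (of_int (c k) * \<sigma> (w k)) \<le> real H * cmod (\<sigma> (w k))"
        by (simp add: norm_mult mult_right_mono)
    qed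
    also have "\<dots> = real H * (\<Sum>k<n. cmod (\<sigma> (w k)))" by (simp add: sum_distrib_left)
    also have "\<dots> \<le> real H * M" using M(2)[OF that(1)] by (intro mult_left_mono) auto
    finally show ?thesis by (simp add: mult.commute)
  qed
  define A where "A = PiE {..<n} (\<lambda>_. {0..int H})"
  \<comment> \<open>A coordinate is at most \<open>M * H\<close> in absolute value and boxes have
    side \<open>3 * M / t\<close>, so the box number lies between the floors of
    \<open>- T / 3\<close> and \<open>T / 3\<close>. These are at most \<open>2 * T / 3 + 2\<close>
    numbers, hence at most \<open>T\<close> because \<open>T \<ge> 6\<close>; this is the reason for
    \<open>t \<ge> 6\<close>. The bound \<open>6 * M / t\<close> arises because a nonreal conjugate
    has two coordinates, each bounded by \<open>3 * M / t\<close>.\<close>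
  define S where "S = {\<lfloor>- (real T / 3)\<rfloor>..\<lfloor>real T / 3\<rfloor>}"
  define g where "g = (\<lambda>c. restrict (\<lambda>\<sigma>. \<lfloor>part \<sigma> (\<sigma> (X c)) * t / (3 * M)\<rfloor>) (E - {\<rho>}))"
  have HT: "real H * real t = real T"
    using n_pos unfolding H_def T_def by (metis Suc_pred' mult.commute of_nat_mult power_Suc)
  have T6: "T \<ge> 6"
  proof -
    have "t ^ 1 \<le> t ^ n" using t n_pos by (intro power_increasing) auto
    then show ?thesis using t by (simp add: T_def)
  qed
  have g_in: "g c \<in> PiE (E - {\<rho>}) (\<lambda>_. S)" if c: "c \<in> A" for c
    unfolding g_def
  proof (intro restrict_PiE_iff[THEN iffD2] ballI)
    fix \<sigma> assume \<sigma>: "\<sigma> \<in> E - {\<rho>}"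
    have cb: "\<bar>c k\<bar> \<le> int H" if "k < n" for k
    proof -
      have "c k \<in> {0..int H}" using PiE_mem[OF c[unfolded A_def], of k] that by simp
      then show ?thesis by simp
    qed
    have "\<bar>part \<sigma> (\<sigma> (X c))\<bar> \<le> M * real H"
      using part_le[of \<sigma> "\<sigma> (X c)"] X_bound[of \<sigma> c] \<sigma> cb by fastforce
    then have "\<bar>part \<sigma> (\<sigma> (X c))\<bar> * t \<le> M * real H * t" by (intro mult_right_mono) auto
    then have "\<bar>part \<sigma> (\<sigma> (X c)) * t\<bar> \<le> M * real T" by (simp add: abs_mult HT mult.assoc)
    then have "\<bar>part \<sigma> (\<sigma> (X c)) * t / (3 * M)\<bar> \<le> real T / 3"
      using M(1) by (simp add: field_simps)
    then have "- (real T / 3) \<le> part \<sigma> (\<sigma> (X c)) * t / (3 * M)" "part \<sigma> (\<sigma> (X c)) * t / (3 * M) \<le> real T / 3"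
      by linarith+
    then show "\<lfloor>part \<sigma> (\<sigma> (X c)) * t / (3 * M)\<rfloor> \<in> S"
      unfolding S_def by (auto intro: floor_mono)
  qed
  have cardS: "card S \<le> T"
  proof -
    have "real_of_int \<lfloor>real T / 3\<rfloor> \<le> real T / 3" by (rule of_int_floor_le)
    moreover have "- (real T / 3) < real_of_int \<lfloor>- (real T / 3)\<rfloor> + 1" by linarith
    ultimately have "real_of_int (\<lfloor>real T / 3\<rfloor> - \<lfloor>- (real T / 3)\<rfloor> + 1) \<le> real_of_int (int T)"
      using of_nat_mono[OF T6, where 'a=real] unfolding of_int_add of_int_diff of_int_of_nat_eq of_int_1
      by linarith
    then have "\<lfloor>real T / 3\<rfloor> - \<lfloor>- (real T / 3)\<rfloor> + 1 \<le> int T" by (simp only: of_int_le_iff)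
    then show ?thesis unfolding S_def by simp
  qed
  have \<rho>E: "\<rho> \<in> E" using \<rho> R_subset by auto
  have finB: "finite (PiE (E - {\<rho>}) (\<lambda>_. S))" by (intro finite_PiE) (auto simp: S_def)
  have "card (PiE (E - {\<rho>}) (\<lambda>_. S)) = card S ^ (n - 1)"
    using \<rho>E by (simp add: card_PiE card_embeddings)
  also have "\<dots> \<le> T ^ (n - 1)" using cardS by (rule power_mono) simp
  also have "\<dots> = H ^ n" by (simp add: T_def H_def power_mult[symmetric] mult.commute)
  also have "\<dots> < (H + 1) ^ n" using n_pos by (intro power_strict_mono) auto
  also have "\<dots> = card A" by (simp add: A_def card_PiE nat_add_distrib)
  finally have lt: "card (PiE (E - {\<rho>}) (\<lambda>_. S)) < card A" .
  have "\<not> inj_on g A"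
  proof
    assume "inj_on g A"
    then have "card A \<le> card (PiE (E - {\<rho>}) (\<lambda>_. S))"
      by (rule card_inj_on_le[OF _ image_subsetI finB]) (rule g_in)
    then show False using lt by simp
  qed
  then obtain c c' where cc: "c \<in> A" "c' \<in> A" "c \<noteq> c'" "g c = g c'"
    unfolding inj_on_def by blast
  define e where "e = (\<lambda>k. c k - c' k)"
  have Xe: "X e = X c - X c'" by (simp add: X_def e_def left_diff_distrib sum_subtractf)
  have small: "\<bar>part \<sigma> (\<sigma> (X e))\<bar> \<le> 3 * M / t" if \<sigma>: "\<sigma> \<in> E" "\<sigma> \<noteq> \<rho>" for \<sigma>
  proof -
    have "\<lfloor>part \<sigma> (\<sigma> (X c)) * t / (3 * M)\<rfloor> = \<lfloor>part \<sigma> (\<sigma> (X c')) * t / (3 * M)\<rfloor>"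
      using fun_cong[OF cc(4), of \<sigma>] \<sigma> by (simp add: g_def)
    then have "\<bar>part \<sigma> (\<sigma> (X c)) * t / (3 * M) - part \<sigma> (\<sigma> (X c')) * t / (3 * M)\<bar> \<le> 1"
      by linarith
    moreover have "part \<sigma> (\<sigma> (X e)) * t / (3 * M) = part \<sigma> (\<sigma> (X c)) * t / (3 * M) - part \<sigma> (\<sigma> (X c')) * t / (3 * M)"
      unfolding Xe by (simp add: emb_diff[OF \<sigma>(1)] XF part_diff left_diff_distrib diff_divide_distrib)
    ultimately have "\<bar>part \<sigma> (\<sigma> (X e)) * t / (3 * M)\<bar> \<le> 1" by simp
    then show ?thesis using M(1) t by (simp add: field_simps abs_mult)
  qed
  show thesis
  proof (rule that[of e])
    obtain k where "c k \<noteq> c' k" using cc(3) by auto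
    moreover have "k < n"
      using cc(1,2) \<open>c k \<noteq> c' k\<close> by (metis A_def PiE_arb lessThan_iff)
    ultimately show "\<exists>k<n. e k \<noteq> 0" by (auto simp: e_def)
  next
    fix \<sigma> assume \<sigma>: "\<sigma> \<in> E" "\<sigma> \<noteq> \<rho>"
    have pos: "3 * M / t \<ge> 0" using M(1) by simp
    have "cmod (\<sigma> (X e)) \<le> 6 * M / t"
    proof (cases "\<sigma> \<in> R")
      case True
      then have "\<sigma> \<noteq> \<tau>'" using \<tau>'_notin by auto
      then show "cmod (\<sigma> (X e)) \<le> 6 * M / t"
        using small[OF \<sigma>] real_cmod[OF True] pos by (simp add: part_def)
    next
      case False
      then have st: "\<sigma> = \<tau> \<or> \<sigma> = \<tau>'" using \<sigma> E_eq by auto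
      have nr: "\<tau> \<noteq> \<rho>" "\<tau>' \<noteq> \<rho>" using \<rho> \<tau>_notin \<tau>'_notin by auto
      have "cmod (\<tau> (X e)) \<le> \<bar>Re (\<tau> (X e))\<bar> + \<bar>Im (\<tau> (X e))\<bar>" by (rule cmod_le)
      moreover have "\<bar>Re (\<tau> (X e))\<bar> \<le> 3 * M / t"
        using small[OF \<tau>_E nr(1)] \<tau>'_neq by (auto simp: part_def split: if_splits)
      moreover have "\<bar>Im (\<tau> (X e))\<bar> \<le> 3 * M / t"
        using small[OF \<tau>'_E nr(2)] by (auto simp: part_def)
      ultimately have "cmod (\<tau> (X e)) \<le> 6 * M / t" by linarith
      then show "cmod (\<sigma> (X e)) \<le> 6 * M / t" using st by auto
    qed
    then show "cmod (\<sigma> (\<Sum>k<n. of_int (e k) * w k)) \<le> 6 * M / t" by (simp only: X_def)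
  next
    have "\<bar>e k\<bar> \<le> int H" if "k < n" for k
    proof -
      have "c k \<in> {0..int H}" "c' k \<in> {0..int H}"
        using PiE_mem[OF cc(1)[unfolded A_def], of k] PiE_mem[OF cc(2)[unfolded A_def], of k] that
        by simp_all
      then show ?thesis by (auto simp: e_def)
    qed
    then show "cmod (\<rho> (\<Sum>k<n. of_int (e k) * w k)) \<le> M * real t ^ (n - 1)"
      using X_bound[OF \<rho>E, of e] by (simp add: X_def H_def)
  qed
qed

end

section \<open>Units\<close>

context OT_field
begin

abbreviation "U \<equiv> totally_positive_units F"

lemma U_OI: "u \<in> U \<Longrightarrow> u \<in> OI" and U_inverse_OI: "u \<in> U \<Longrightarrow> inverse u \<in> OI"
  and U_nonzero: "u \<in> U \<Longrightarrow> u \<noteq> 0" and U_pos: "u \<in> U \<Longrightarrow> \<sigma> \<in> R \<Longrightarrow> 0 < Re (\<sigma> u)"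
  by (auto simp: totally_positive_units_def)

lemma U_in: "u \<in> U \<Longrightarrow> u \<in> F"
  using U_OI OI_in by blast

lemma U_val: "u \<in> U \<Longrightarrow> \<sigma> \<in> R \<Longrightarrow> \<sigma> u = of_real (cmod (\<sigma> u))"
  using U_pos[of u \<sigma>] real_cmod[of \<sigma> u] real_val[of \<sigma> u] by (simp add: complex_eq_iff complex_is_Real_iff)

lemma U_cmod_pos: "u \<in> U \<Longrightarrow> \<sigma> \<in> E \<Longrightarrow> 0 < cmod (\<sigma> u)"
  using emb_eq_0_iff[of \<sigma> u] U_in U_nonzero by simp

lemma UI: "u \<in> OI \<Longrightarrow> inverse u \<in> OI \<Longrightarrow> u \<noteq> 0 \<Longrightarrow> (\<And>\<sigma>. \<sigma> \<in> R \<Longrightarrow> 0 < Re (\<sigma> u)) \<Longrightarrow> u \<in> U"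
  by (auto simp: totally_positive_units_def)

lemma real_emb: "\<sigma> \<in> R \<Longrightarrow> \<sigma> \<in> E"
  using R_subset by auto

lemma U_mult:
  assumes "u \<in> U" "v \<in> U"
  shows "u * v \<in> U"
proof (rule UI)
  fix \<sigma> assume \<sigma>: "\<sigma> \<in> R"
  have "Im (\<sigma> u) = 0" "Im (\<sigma> v) = 0" using real_val[OF \<sigma>] by (auto simp: complex_is_Real_iff)
  then show "0 < Re (\<sigma> (u * v))"
    using U_pos[OF assms(1) \<sigma>] U_pos[OF assms(2) \<sigma>]
    by (simp add: emb_mult[OF real_emb[OF \<sigma>] U_in[OF assms(1)] U_in[OF assms(2)]])
qed (use assms in \<open>auto simp: U_nonzero U_OI U_inverse_OI intro!: OI_mult\<close>)

lemma U_inverse: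
  assumes "u \<in> U"
  shows "inverse u \<in> U"
proof (rule UI)
  fix \<sigma> assume \<sigma>: "\<sigma> \<in> R"
  have "\<sigma> (inverse u) = of_real (inverse (cmod (\<sigma> u)))"
    using emb_inverse[OF real_emb[OF \<sigma>] U_in[OF assms]] U_val[OF assms \<sigma>] by (metis of_real_inverse)
  then show "0 < Re (\<sigma> (inverse u))"
    using U_cmod_pos[OF assms real_emb[OF \<sigma>]] by simp
qed (use assms in \<open>auto simp: U_nonzero U_OI U_inverse_OI\<close>)

lemma U_one: "1 \<in> U"
  by (rule UI) (auto simp: OI_one emb_one[OF real_emb])

lemma U_power: "u \<in> U \<Longrightarrow> u ^ k \<in> U"
  by (induction k) (auto simp: U_one U_mult)

lemma U_powi: "u \<in> U \<Longrightarrow> u powi k \<in> U"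
  by (auto simp: power_int_def U_power U_inverse)

lemma U_prod: "(\<And>i. i \<in> I \<Longrightarrow> f i \<in> U) \<Longrightarrow> (\<Prod>i\<in>I. f i) \<in> U"
  by (induction I rule: infinite_finite_induct) (auto simp: U_one U_mult)

text \<open>The products of absolute values for \<open>u\<close> and for \<open>inverse u\<close>
  are both at least 1 and are inverse to each other.\<close>

lemma U_product_formula:
  assumes u: "u \<in> U"
  shows "(cmod (\<tau> u))\<^sup>2 * (\<Prod>\<sigma>\<in>R. cmod (\<sigma> u)) = 1"
proof -
  define P where "P = (\<Prod>\<sigma>\<in>E. cmod (\<sigma> u))"
  have "1 \<le> P" unfolding P_def by (rule cmod_norm_ge_1[OF U_OI[OF u] U_nonzero[OF u]])
  moreover have "1 \<le> inverse P"
  proof -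
    have "1 \<le> (\<Prod>\<sigma>\<in>E. cmod (\<sigma> (inverse u)))"
      using U_inverse[OF u] by (intro cmod_norm_ge_1 U_OI U_nonzero)
    also have "\<dots> = (\<Prod>\<sigma>\<in>E. inverse (cmod (\<sigma> u)))"
      by (intro prod.cong refl) (simp add: emb_inverse[OF _ U_in[OF u]] norm_inverse)
    also have "\<dots> = inverse P" by (simp add: P_def prod_inversef[symmetric])
    finally show ?thesis .
  qed
  ultimately have "P = 1" by (simp add: one_le_inverse_iff)
  then show ?thesis by (simp add: P_def prod_cmod_E)
qed

text \<open>Dirichlet's argument: among infinitely many integers of bounded norm that become small away from
  \<open>\<rho>\<close>, two are congruent modulo a common multiple of their norms, so their quotient is a unit.\<close>

lemma ex_unit_small_away:
  assumes \<rho>: "\<rho> \<in> R"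
  obtains u where "u \<in> U" "\<And>\<sigma>. \<sigma> \<in> E \<Longrightarrow> \<sigma> \<noteq> \<rho> \<Longrightarrow> cmod (\<sigma> u) < 1"
proof -
  have \<rho>E: "\<rho> \<in> E" using \<rho> by (rule real_emb)
  obtain w where w: "\<And>i. i < n \<Longrightarrow> w i \<in> OI"
    and indep: "\<And>c :: nat \<Rightarrow> int. (\<Sum>i<n. of_int (c i) * w i) = 0 \<Longrightarrow> \<forall>i<n. c i = 0"
    using ex_integral_basis by metis
  have wF: "w k \<in> F" if "k < n" for k using w[OF that] by (rule OI_in)
  define M where "M = 1 + (\<Sum>\<sigma>\<in>E. \<Sum>k<n. cmod (\<sigma> (w k)))"
  have M1: "M \<ge> 1" by (simp add: M_def sum_nonneg)
  have M2: "(\<Sum>k<n. cmod (\<sigma> (w k))) \<le> M" if "\<sigma> \<in> E" for \<sigma>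
  proof -
    have "(\<Sum>k<n. cmod (\<sigma> (w k))) \<le> (\<Sum>\<sigma>\<in>E. \<Sum>k<n. cmod (\<sigma> (w k)))"
      using that by (intro member_le_sum[where f="\<lambda>\<sigma>. \<Sum>k<n. cmod (\<sigma> (w k))"]) (auto intro: sum_nonneg)
    then show ?thesis by (simp add: M_def)
  qed
  define X where "X = (\<lambda>c :: nat \<Rightarrow> int. \<Sum>k<n. of_int (c k) * w k)"
  have X_OI: "X c \<in> OI" for c
    unfolding X_def using w by (auto intro!: OI_sum OI_mult OI_of_int)
  have "\<exists>e. t \<ge> 6 \<longrightarrow> (\<exists>k<n. e k \<noteq> 0) \<and> (\<forall>\<sigma>\<in>E. \<sigma> \<noteq> \<rho> \<longrightarrow> cmod (\<sigma> (X e)) \<le> 6 * M / t)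
      \<and> cmod (\<rho> (X e)) \<le> M * real t ^ (n - 1)" for t :: nat
  proof (cases "t \<ge> 6")
    case True
    show ?thesis
      by (rule ex_small_combination[where w=w and M=M, OF \<rho> wF M1 M2 True]) (auto simp: X_def)
  qed auto
  then obtain e where e: "\<And>t::nat. t \<ge> 6 \<Longrightarrow> \<exists>k<n. e t k \<noteq> 0"
    "\<And>t \<sigma>. t \<ge> 6 \<Longrightarrow> \<sigma> \<in> E \<Longrightarrow> \<sigma> \<noteq> \<rho> \<Longrightarrow> cmod (\<sigma> (X (e t))) \<le> 6 * M / t"
    "\<And>t. t \<ge> 6 \<Longrightarrow> cmod (\<rho> (X (e t))) \<le> M * real t ^ (n - 1)"
    by metis
  define x where "x = (\<lambda>t. X (e t))"
  have x_OI: "x t \<in> OI" for t by (simp add: x_def X_OI)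
  have x_F: "x t \<in> F" for t using x_OI by (rule OI_in)
  have x_nz: "x t \<noteq> 0" if "t \<ge> 6" for t
    using e(1)[OF that] indep[of "e t"] by (auto simp: x_def X_def)
  \<comment> \<open>The powers of \<open>t\<close> cancel between the factor at
    \<open>\<rho>\<close> and the \<open>n - 1\<close> other factors, so \<open>C\<close> bounds the
    norms of all \<open>x t\<close> with \<open>t \<ge> 6\<close>. Every such norm therefore divides
    the factorial \<open>D\<close>.\<close>
  define C where "C = nat \<lceil>(6 * M) ^ (n - 1) * M\<rceil>"
  define D where "D = int (fact C)"
  have D: "D > 0" by (simp add: D_def)
  have norm_dvd_D: "\<exists>N. norm_of (x t) = of_int N \<and> N dvd D" if t: "t \<ge> 6" for t
  proof -
    obtain N where N: "norm_of (x t) = of_int N" using norm_of_int[OF x_OI] by (auto elim: Ints_cases)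
    have N0: "N \<noteq> 0" using norm_of_eq_0_iff[OF x_F, of t] x_nz[OF t] N by auto
    have "real_of_int \<bar>N\<bar> = (\<Prod>\<sigma>\<in>E. cmod (\<sigma> (x t)))"
      using arg_cong[OF N, of cmod] by (simp add: norm_of_def prod_norm)
    also have "\<dots> = cmod (\<rho> (x t)) * (\<Prod>\<sigma>\<in>E - {\<rho>}. cmod (\<sigma> (x t)))"
      using \<rho>E by (simp add: prod.remove)
    also have "\<dots> \<le> (M * real t ^ (n - 1)) * (\<Prod>\<sigma>\<in>E - {\<rho>}. 6 * M / t)"
      using e(2,3)[OF t] M1 by (intro mult_mono prod_mono prod_nonneg) (auto simp: x_def)
    also have "(\<Prod>\<sigma>\<in>E - {\<rho>}. 6 * M / t) = (6 * M / t) ^ (n - 1)"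
      using \<rho>E by (simp add: card_embeddings)
    also have "M * real t ^ (n - 1) * (6 * M / t) ^ (n - 1) = (6 * M) ^ (n - 1) * M"
      using t by (simp add: power_divide)
    also have "\<dots> \<le> real C" unfolding C_def by (rule real_nat_ceiling_ge)
    finally have "\<bar>N\<bar> \<le> int C" by linarith
    then have "nat \<bar>N\<bar> dvd fact C" using N0 by (intro dvd_fact) auto
    then have "int (nat \<bar>N\<bar>) dvd D" unfolding D_def by (simp only: of_nat_dvd_iff)
    then show ?thesis using N by auto
  qed
  define g where "g = (\<lambda>t. restrict (\<lambda>k. e t k mod D) {..<n})"
  have "g ` {6..} \<subseteq> PiE {..<n} (\<lambda>_. {0..<D})"
    unfolding g_def using D by (intro image_subsetI restrict_PiE_iff[THEN iffD2]) auto
  then have "finite (g ` {6..})"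
    by (rule finite_subset) (auto intro: finite_PiE)
  then obtain t1 where t1: "t1 \<in> {6..}" "infinite {t \<in> {6..}. g t = g t1}"
    using pigeonhole_infinite[of "{6..}" g] infinite_Ici by auto
  \<comment> \<open>Infinitely many \<open>t\<close> share the residues of \<open>t1\<close> modulo
    \<open>D\<close>. With \<open>t1\<close> fixed, \<open>t2\<close> can be taken so large that
    every conjugate of \<open>x t2\<close> away from \<open>\<rho>\<close> is smaller than
    \<open>\<delta>\<close>, the least absolute value of a conjugate of \<open>x t1\<close>.\<close>
  define \<delta> where "\<delta> = Min ((\<lambda>\<sigma>. cmod (\<sigma> (x t1))) ` E)"
  have E0: "E \<noteq> {}" using \<rho>E by auto
  have x1_nz: "\<sigma> (x t1) \<noteq> 0" if "\<sigma> \<in> E" for \<sigma>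
    using emb_eq_0_iff[OF that x_F] x_nz[of t1] t1(1) by simp
  have \<delta>: "\<delta> > 0" unfolding \<delta>_def using E0 x1_nz by (subst Min_gr_iff) auto
  have \<delta>_le: "\<delta> \<le> cmod (\<sigma> (x t1))" if "\<sigma> \<in> E" for \<sigma>
    unfolding \<delta>_def using that by (intro Min_le) auto
  obtain m :: nat where m: "6 * M / \<delta> < real m" using reals_Archimedean2 by blast
  obtain t2 where t2: "t2 \<ge> 6" "g t2 = g t1" "t2 > m"
    using infinite_nat_iff_unbounded[THEN iffD1, OF t1(2)] by blast
  have t1': "t1 \<ge> 6" using t1(1) by simp
  define y where "y = X (\<lambda>k. (e t2 k - e t1 k) div D)"
  have "x t2 - x t1 = (\<Sum>k<n. of_int (e t2 k - e t1 k) * w k)"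
    by (simp add: x_def X_def left_diff_distrib sum_subtractf)
  also have "\<dots> = (\<Sum>k<n. of_int D * (of_int ((e t2 k - e t1 k) div D) * w k))"
  proof (intro sum.cong refl)
    fix k assume "k \<in> {..<n}"
    then have "e t2 k mod D = e t1 k mod D" using fun_cong[OF t2(2), of k] by (simp add: g_def)
    then have "D dvd e t2 k - e t1 k" by (rule mod_eq_dvd_iff[THEN iffD1])
    then have "e t2 k - e t1 k = D * ((e t2 k - e t1 k) div D)" by simp
    then have "complex_of_int (e t2 k - e t1 k) = of_int D * of_int ((e t2 k - e t1 k) div D)"
      by (metis of_int_mult)
    then show "complex_of_int (e t2 k - e t1 k) * w k = of_int D * (of_int ((e t2 k - e t1 k) div D) * w k)"
      by (simp only: mult.assoc)
  qed
  also have "\<dots> = of_int D * y" by (simp only: sum_distrib_left y_def X_def)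
  finally have diff: "x t2 - x t1 = of_int D * y" .
  define v where "v = x t2 / x t1"
  have y: "y \<in> OI" by (simp add: y_def X_OI)
  have v1: "v \<in> OI"
    unfolding v_def using norm_dvd_D[OF t1'] quotient_integral[OF x_OI x_OI x_nz[OF t1'] y diff] by blast
  have diff': "x t1 - x t2 = of_int D * (- y)" using diff by (simp add: algebra_simps)
  have "x t1 / x t2 \<in> OI"
    using norm_dvd_D[OF t2(1)] quotient_integral[OF x_OI x_OI x_nz[OF t2(1)] OI_uminus[OF y] diff'] by blast
  then have v2: "inverse v \<in> OI" by (simp add: v_def)
  have v0: "v \<noteq> 0" using x_nz[OF t1'] x_nz[OF t2(1)] by (simp add: v_def)
  have vF: "v \<in> F" using v1 by (rule OI_in)
  have v_small: "cmod (\<sigma> v) < 1" if \<sigma>: "\<sigma> \<in> E" "\<sigma> \<noteq> \<rho>" for \<sigma>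
  proof -
    have "cmod (\<sigma> (x t2)) \<le> 6 * M / t2" using e(2)[OF t2(1) \<sigma>] by (simp add: x_def)
    also have "\<dots> < \<delta>"
    proof -
      have "6 * M / \<delta> < real t2" using m t2(3) by linarith
      then show ?thesis using \<delta> t2(1) by (simp add: field_simps)
    qed
    also have "\<dots> \<le> cmod (\<sigma> (x t1))" by (rule \<delta>_le[OF \<sigma>(1)])
    finally show ?thesis
      using x1_nz[OF \<sigma>(1)] by (simp add: v_def emb_divide[OF \<sigma>(1) x_F x_F] norm_divide)
  qed
  \<comment> \<open>Squaring makes the unit positive at every real embedding and keeps it small away
    from \<open>\<rho>\<close>.\<close>
  show thesis
  proof (rule that[of "v\<^sup>2"])
    show "v\<^sup>2 \<in> U"
    proof (rule UI)
      fix \<sigma> assume \<sigma>: "\<sigma> \<in> R"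
      have "\<sigma> v \<noteq> 0" using emb_eq_0_iff[OF real_emb[OF \<sigma>] vF] v0 by simp
      moreover have "Im (\<sigma> v) = 0" using real_val[OF \<sigma>] by (simp add: complex_is_Real_iff)
      ultimately have "Re (\<sigma> v) \<noteq> 0" by (simp add: complex_eq_iff)
      then show "0 < Re (\<sigma> (v\<^sup>2))"
        using \<open>Im (\<sigma> v) = 0\<close> by (simp add: emb_power[OF real_emb[OF \<sigma>] vF])
    qed (use v1 v2 v0 in \<open>auto simp: OI_power simp flip: power_inverse\<close>)
  next
    fix \<sigma> assume \<sigma>: "\<sigma> \<in> E" "\<sigma> \<noteq> \<rho>"
    have "cmod (\<sigma> v) ^ 2 < 1 ^ 2" using v_small[OF \<sigma>] by (intro power_strict_mono) auto
    then show "cmod (\<sigma> (v\<^sup>2)) < 1" by (simp add: emb_power[OF \<sigma>(1) vF] norm_power)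
  qed
qed

text \<open>The doubled parts are rounded, so two integers in one box have real and imaginary parts
  closer than 1/2 at every embedding. All conjugates of the difference then have absolute value
  below 1, and so has its norm, which forces the difference to be 0.\<close>

lemma finite_bounded_integers: "finite {x \<in> OI. \<forall>\<sigma>\<in>E. cmod (\<sigma> x) \<le> B}" (is "finite ?S")
proof -
  define S where "S = {\<lfloor>- (2 * B)\<rfloor>..\<lfloor>2 * B\<rfloor>}"
  define g where "g = (\<lambda>x. restrict (\<lambda>\<sigma>. (\<lfloor>2 * Re (\<sigma> x)\<rfloor>, \<lfloor>2 * Im (\<sigma> x)\<rfloor>)) E)"
  have g_in: "g x \<in> PiE E (\<lambda>_. S \<times> S)" if "x \<in> ?S" for x
    unfolding g_def
  proof (intro restrict_PiE_iff[THEN iffD2] ballI)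
    fix \<sigma> assume "\<sigma> \<in> E"
    then have "cmod (\<sigma> x) \<le> B" using that by blast
    then have "\<bar>Re (\<sigma> x)\<bar> \<le> B" "\<bar>Im (\<sigma> x)\<bar> \<le> B"
      using abs_Re_le_cmod[of "\<sigma> x"] abs_Im_le_cmod[of "\<sigma> x"] by linarith+
    then have "- (2 * B) \<le> 2 * Re (\<sigma> x)" "2 * Re (\<sigma> x) \<le> 2 * B"
      "- (2 * B) \<le> 2 * Im (\<sigma> x)" "2 * Im (\<sigma> x) \<le> 2 * B" by linarith+
    then show "(\<lfloor>2 * Re (\<sigma> x)\<rfloor>, \<lfloor>2 * Im (\<sigma> x)\<rfloor>) \<in> S \<times> S"
      by (auto simp: S_def intro!: floor_mono)
  qed
  have "finite (PiE E (\<lambda>_. S \<times> S))" by (intro finite_PiE) (auto simp: S_def)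
  then have "finite (g ` ?S)" by (rule finite_subset[OF image_subsetI, rotated]) (rule g_in)
  moreover have "inj_on g ?S"
  proof (rule inj_onI)
    fix x y assume xy: "x \<in> ?S" "y \<in> ?S" "g x = g y"
    have F: "x \<in> F" "y \<in> F" using xy by (auto intro: OI_in)
    have lt: "cmod (\<sigma> (x - y)) < 1" if \<sigma>: "\<sigma> \<in> E" for \<sigma>
    proof -
      have "\<lfloor>2 * Re (\<sigma> x)\<rfloor> = \<lfloor>2 * Re (\<sigma> y)\<rfloor>" "\<lfloor>2 * Im (\<sigma> x)\<rfloor> = \<lfloor>2 * Im (\<sigma> y)\<rfloor>"
        using fun_cong[OF xy(3), of \<sigma>] \<sigma> by (simp_all add: g_def)
      then have "\<bar>Re (\<sigma> x) - Re (\<sigma> y)\<bar> < 1 / 2" "\<bar>Im (\<sigma> x) - Im (\<sigma> y)\<bar> < 1 / 2"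
        by linarith+
      then have "\<bar>Re (\<sigma> (x - y))\<bar> < 1 / 2" "\<bar>Im (\<sigma> (x - y))\<bar> < 1 / 2"
        by (simp_all add: emb_diff[OF \<sigma> F])
      then show ?thesis using cmod_le[of "\<sigma> (x - y)"] by linarith
    qed
    show "x = y"
    proof (rule ccontr)
      assume "x \<noteq> y"
      then have "1 \<le> (\<Prod>\<sigma>\<in>E. cmod (\<sigma> (x - y)))"
        using xy by (intro cmod_norm_ge_1 OI_diff) auto
      moreover have "(\<Prod>\<sigma>\<in>E. cmod (\<sigma> (x - y))) < 1"
      proof -
        have "(\<Prod>\<sigma>\<in>E. cmod (\<sigma> (x - y))) = cmod (\<tau> (x - y)) * (\<Prod>\<sigma>\<in>E - {\<tau>}. cmod (\<sigma> (x - y)))"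
          using \<tau>_E by (simp add: prod.remove)
        also have "\<dots> \<le> cmod (\<tau> (x - y)) * 1"
          using lt by (intro mult_left_mono prod_le_1) (auto intro: less_imp_le)
        also have "\<dots> < 1" using lt[OF \<tau>_E] by simp
        finally show ?thesis .
      qed
      ultimately show False by simp
    qed
  qed
  ultimately show ?thesis by (rule finite_imageD)
qed

end

text \<open>Let \<open>Q\<close> be the set of rows with positive coefficient, and add the column
  relations over \<open>Q\<close>. A row in \<open>Q\<close> contributes a positive amount, since
  dropping the columns outside \<open>Q\<close> from its positive sum removes only nonpositive
  entries. A row outside \<open>Q\<close> pairs a nonpositive coefficient with nonpositive entries.
  So the total is positive as soon as \<open>Q\<close> is nonempty, but it is 0.\<close>

lemma dominant_nonpos:
  fixes a :: "'i \<Rightarrow> 'i \<Rightarrow> real"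
  assumes "finite P" and off: "\<And>i j. i \<in> P \<Longrightarrow> j \<in> P \<Longrightarrow> i \<noteq> j \<Longrightarrow> a i j \<le> 0"
    and row: "\<And>i. i \<in> P \<Longrightarrow> 0 < (\<Sum>j\<in>P. a i j)"
    and col: "\<And>j. j \<in> P \<Longrightarrow> (\<Sum>i\<in>P. c i * a i j) = 0" and i: "i \<in> P"
  shows "c i \<le> 0"
proof (rule ccontr)
  assume ci: "\<not> c i \<le> 0"
  define Q where "Q = {j \<in> P. c j > 0}"
  have Q: "Q \<subseteq> P" "finite Q" "i \<in> Q" using assms(1) i ci by (auto simp: Q_def)
  have "0 < (\<Sum>k\<in>Q. c k * (\<Sum>j\<in>Q. a k j))"
  proof (intro sum_pos)
    fix k assume k: "k \<in> Q"
    have "(\<Sum>j\<in>P. a k j) = (\<Sum>j\<in>Q. a k j) + (\<Sum>j\<in>P - Q. a k j)"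
      using assms(1) Q(1) by (metis add.commute sum.subset_diff)
    moreover have "(\<Sum>j\<in>P - Q. a k j) \<le> 0" using k Q(1) by (intro sum_nonpos off) auto
    ultimately have "0 < (\<Sum>j\<in>Q. a k j)" using row[of k] k Q(1) by force
    then show "0 < c k * (\<Sum>j\<in>Q. a k j)" using k by (simp add: Q_def)
  qed (use Q in auto)
  moreover have "0 \<le> (\<Sum>k\<in>P - Q. c k * (\<Sum>j\<in>Q. a k j))"
  proof (intro sum_nonneg mult_nonpos_nonpos sum_nonpos)
    fix k assume "k \<in> P - Q"
    then show "c k \<le> 0" by (auto simp: Q_def)
  next
    fix k j assume "k \<in> P - Q" "j \<in> Q"
    then show "a k j \<le> 0" using Q(1) by (intro off) auto
  qed
  ultimately have "0 < (\<Sum>k\<in>P. c k * (\<Sum>j\<in>Q. a k j))"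
    using sum.subset_diff[OF Q(1) assms(1), of "\<lambda>k. c k * (\<Sum>j\<in>Q. a k j)"] by linarith
  also have "\<dots> = (\<Sum>j\<in>Q. \<Sum>k\<in>P. c k * a k j)"
    unfolding sum_distrib_left by (rule sum.swap)
  also have "\<dots> = 0" using col Q(1) by (intro sum.neutral) auto
  finally show False by simp
qed

lemma dominant_eq_0:
  fixes a :: "'i \<Rightarrow> 'i \<Rightarrow> real"
  assumes "finite P" and off: "\<And>i j. i \<in> P \<Longrightarrow> j \<in> P \<Longrightarrow> i \<noteq> j \<Longrightarrow> a i j \<le> 0"
    and row: "\<And>i. i \<in> P \<Longrightarrow> 0 < (\<Sum>j\<in>P. a i j)"
    and col: "\<And>j. j \<in> P \<Longrightarrow> (\<Sum>i\<in>P. c i * a i j) = 0" and i: "i \<in> P"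
  shows "c i = 0"
proof (rule antisym)
  show "c i \<le> 0" by (rule dominant_nonpos[OF assms])
  have "- c i \<le> 0"
    by (rule dominant_nonpos[where c="\<lambda>i. - c i", OF assms(1) off row _ i]) (auto simp: sum_negf col)
  then show "0 \<le> c i" by simp
qed

section \<open>The rank of the dilation group\<close>

text \<open>\<open>mult_indep\<close> speaks of sets, whereas units come as indexed families. Equal
  values at two indices would give a relation with exponents 1 and -1, so the family does not
  collapse.\<close>

lemma mult_indep_image:
  fixes g :: "'i \<Rightarrow> real"
  assumes P: "finite P" and pos: "\<And>i. i \<in> P \<Longrightarrow> g i > 0"
    and ind: "\<And>k :: 'i \<Rightarrow> int. (\<Prod>i\<in>P. g i powi k i) = 1 \<Longrightarrow> \<forall>i\<in>P. k i = 0"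
  shows "mult_indep (g ` P)" and "card (g ` P) = card P"
proof -
  have inj: "inj_on g P"
  proof (rule inj_onI, rule ccontr)
    fix i j assume ij: "i \<in> P" "j \<in> P" "g i = g j" "i \<noteq> j"
    define k :: "'i \<Rightarrow> int" where "k = (\<lambda>l. if l = i then 1 else if l = j then -1 else 0)"
    have "(\<Prod>l\<in>P. g l powi k l) = g i powi k i * (g j powi k j * (\<Prod>l\<in>P - {i} - {j}. g l powi k l))"
      using P ij by (subst prod.remove[of P i], simp_all) (subst prod.remove[of "P - {i}" j], simp_all)
    also have "(\<Prod>l\<in>P - {i} - {j}. g l powi k l) = 1"
      by (intro prod.neutral) (auto simp: k_def)
    also have "g i powi k i * (g j powi k j * 1) = 1"
      using ij pos[of j] by (simp add: k_def power_int_minus)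
    finally have "k i = 0" using ind ij(1) by blast
    then show False by (simp add: k_def)
  qed
  then show "card (g ` P) = card P" by (rule card_image)
  show "mult_indep (g ` P)"
    unfolding mult_indep_def
  proof (intro conjI allI impI)
    fix k :: "real \<Rightarrow> int" assume "(\<Prod>x\<in>g ` P. x powi k x) = 1"
    then have "(\<Prod>i\<in>P. g i powi k (g i)) = 1" by (simp add: prod.reindex[OF inj])
    then show "\<forall>x\<in>g ` P. k x = 0" using ind[of "\<lambda>i. k (g i)"] by blast
  qed (use P pos in auto)
qed

lemma card_le_mult_fibers:
  assumes "finite A" "g ` A \<subseteq> Y" "finite Y" "\<And>y. card {x \<in> A. g x = y} \<le> c"
  shows "card A \<le> card Y * c"
proof -
  have "A = (\<Union>y\<in>g ` A. {x \<in> A. g x = y})" by auto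
  then have "card A \<le> (\<Sum>y\<in>g ` A. card {x \<in> A. g x = y})"
    using card_UN_le[of "g ` A" "\<lambda>y. {x \<in> A. g x = y}"] assms(1) by simp
  also have "\<dots> \<le> card (g ` A) * c"
    using sum_bounded_above[of "g ` A" "\<lambda>y. card {x \<in> A. g x = y}" c] assms(4) by simp
  also have "\<dots> \<le> card Y * c" using assms by (intro mult_right_mono card_mono) auto
  finally show ?thesis .
qed

context OT_field
begin

lemma OT_dilation_factors_eq: "OT_dilation_factors F \<tau> = (\<lambda>u. (cmod (\<tau> u))\<^sup>2) ` U"
  using OI_one by (auto simp: OT_dilation_factors_def)

lemma U_comb:
  assumes "\<And>i. i \<in> I \<Longrightarrow> u i \<in> U"
  shows "(\<Prod>i\<in>I. u i powi k i) \<in> U"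
  using assms by (intro U_prod U_powi)

lemma cmod_U_comb:
  assumes "\<And>i. i \<in> I \<Longrightarrow> u i \<in> U" "\<sigma> \<in> E"
  shows "cmod (\<sigma> (\<Prod>i\<in>I. u i powi k i)) = (\<Prod>i\<in>I. cmod (\<sigma> (u i)) powi k i)"
proof -
  have uF: "u i \<in> F" if "i \<in> I" for i using assms(1)[OF that] by (rule U_in)
  have "\<sigma> (\<Prod>i\<in>I. u i powi k i) = (\<Prod>i\<in>I. \<sigma> (u i powi k i))"
    using uF by (intro emb_prod[OF assms(2)] powi_in)
  also have "\<dots> = (\<Prod>i\<in>I. \<sigma> (u i) powi k i)"
    using uF by (intro prod.cong refl emb_powi[OF assms(2)])
  also have "cmod \<dots> = (\<Prod>i\<in>I. cmod (\<sigma> (u i)) powi k i)"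
    by (simp add: prod_norm[symmetric] norm_power_int)
  finally show ?thesis .
qed

lemma dilation_U_comb:
  assumes "\<And>i. i \<in> I \<Longrightarrow> u i \<in> U"
  shows "(cmod (\<tau> (\<Prod>i\<in>I. u i powi k i)))\<^sup>2 = (\<Prod>i\<in>I. (cmod (\<tau> (u i)))\<^sup>2 powi k i)"
proof -
  have "cmod (\<tau> (\<Prod>i\<in>I. u i powi k i)) = (\<Prod>i\<in>I. cmod (\<tau> (u i)) powi k i)"
    using assms \<tau>_E by (rule cmod_U_comb)
  then have "(cmod (\<tau> (\<Prod>i\<in>I. u i powi k i)))\<^sup>2 = (\<Prod>i\<in>I. (cmod (\<tau> (u i)) powi k i)\<^sup>2)"
    by (simp only: prod_power_distrib)
  then show ?thesis by (simp only: power2_eq_square power_int_mult_distrib)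
qed

lemma ln_U_comb:
  assumes "finite I" "\<And>i. i \<in> I \<Longrightarrow> u i \<in> U" "\<sigma> \<in> E"
  shows "ln (cmod (\<sigma> (\<Prod>i\<in>I. u i powi k i))) = (\<Sum>i\<in>I. of_int (k i) * ln (cmod (\<sigma> (u i))))"
proof -
  have pos: "0 < cmod (\<sigma> (u i))" if "i \<in> I" for i
    using assms(2)[OF that] assms(3) by (rule U_cmod_pos)
  have "ln (\<Prod>i\<in>I. cmod (\<sigma> (u i)) powi k i) = (\<Sum>i\<in>I. ln (cmod (\<sigma> (u i)) powi k i))"
    using pos assms(1) by (intro ln_prod) fastforce+
  also have "\<dots> = (\<Sum>i\<in>I. of_int (k i) * ln (cmod (\<sigma> (u i))))"
  proof (intro sum.cong refl)
    fix i assume "i \<in> I"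
    then have "cmod (\<sigma> (u i)) powi k i = cmod (\<sigma> (u i)) powr of_int (k i)"
      using pos by (simp add: powr_real_of_int')
    then show "ln (cmod (\<sigma> (u i)) powi k i) = of_int (k i) * ln (cmod (\<sigma> (u i)))"
      using pos \<open>i \<in> I\<close> by (simp add: ln_powr)
  qed
  finally show ?thesis by (simp add: cmod_U_comb assms)
qed

end

text \<open>The rank is the number of blocks of \<open>\<P>\<close> as soon as a unit \<open>\<nu> w\<close> whose conjugates are
  the block products of the conjugates of \<open>w\<close> carries the same information as the dilation factor of \<open>w\<close>.
  Singleton blocks with \<open>\<nu> w = w\<close> and two-element blocks with a relative norm \<open>\<nu>\<close>
  give the two possible ranks.\<close>

locale OT_blocks = OT_field +
  fixes \<P> :: "(complex \<Rightarrow> complex) set set" and \<nu> :: "complex \<Rightarrow> complex"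
  assumes blocks: "\<Union>\<P> = real_embeddings F" "{} \<notin> \<P>"
    and disjoint: "\<And>B C. B \<in> \<P> \<Longrightarrow> C \<in> \<P> \<Longrightarrow> B \<noteq> C \<Longrightarrow> B \<inter> C = {}"
    and \<nu>_U: "\<And>w. w \<in> totally_positive_units F \<Longrightarrow> \<nu> w \<in> totally_positive_units F"
    and \<nu>_block: "\<And>w B \<sigma>. w \<in> totally_positive_units F \<Longrightarrow> B \<in> \<P> \<Longrightarrow> \<sigma> \<in> B \<Longrightarrow>
        cmod (\<sigma> (\<nu> w)) = (\<Prod>\<rho>\<in>B. cmod (\<rho> w))"
    and \<nu>_one: "\<And>w. w \<in> totally_positive_units F \<Longrightarrow> cmod (\<tau> w) = 1 \<Longrightarrow> \<nu> w = 1"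
    and \<nu>_determines: "\<And>w w'. w \<in> totally_positive_units F \<Longrightarrow> w' \<in> totally_positive_units F \<Longrightarrow>
        \<nu> w = \<nu> w' \<Longrightarrow> cmod (\<tau> w) = cmod (\<tau> w')"
begin

lemma finite_blocks [simp, intro]: "finite \<P>"
  using blocks(1) finite_R by (metis finite_UnionD)

lemma block_subset: "B \<in> \<P> \<Longrightarrow> B \<subseteq> R"
  using blocks by blast

lemma finite_block: "B \<in> \<P> \<Longrightarrow> finite B"
  using block_subset finite_R by (rule finite_subset)

lemma block_nonempty: "B \<in> \<P> \<Longrightarrow> \<exists>\<sigma>. \<sigma> \<in> B"
  using blocks(2) by (cases "B = {}") auto

lemma sum_blocks: "(\<Sum>B\<in>\<P>. \<Sum>\<sigma>\<in>B. f \<sigma>) = (\<Sum>\<sigma>\<in>R. f \<sigma>)" for f :: "_ \<Rightarrow> real"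
  using sum.Union_disjoint[of \<P> f] finite_block disjoint blocks(1) by (simp add: comp_def)

definition block_log :: "(complex \<Rightarrow> complex) set \<Rightarrow> complex \<Rightarrow> real" where
  "block_log B w = (\<Sum>\<sigma>\<in>B. ln (cmod (\<sigma> w)))"

lemma block_log_comb:
  assumes "finite I" "\<And>i. i \<in> I \<Longrightarrow> u i \<in> U" "B \<in> \<P>"
  shows "block_log B (\<Prod>i\<in>I. u i powi k i) = (\<Sum>i\<in>I. of_int (k i) * block_log B (u i))"
proof -
  have "block_log B (\<Prod>i\<in>I. u i powi k i) = (\<Sum>\<sigma>\<in>B. \<Sum>i\<in>I. of_int (k i) * ln (cmod (\<sigma> (u i))))"
    unfolding block_log_def
    using block_subset[OF assms(3)] assms(1,2) by (intro sum.cong refl ln_U_comb real_emb) auto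
  then show ?thesis unfolding block_log_def sum_distrib_left by (simp only: sum.swap[of _ I B])
qed

lemma block_log_\<nu>:
  assumes "w \<in> U" "B \<in> \<P>" "\<sigma> \<in> B"
  shows "ln (cmod (\<sigma> (\<nu> w))) = block_log B w"
proof -
  have "cmod (\<rho> w) \<noteq> 0" if "\<rho> \<in> B" for \<rho>
    using U_cmod_pos[OF assms(1), of \<rho>] block_subset[OF assms(2)] that R_subset by fastforce
  then show ?thesis
    unfolding \<nu>_block[OF assms] block_log_def using finite_block[OF assms(2)] by (intro ln_prod) auto
qed

text \<open>Choose one unit per block that is small away from a representative of the block. In the
  matrix of block logarithms the off-diagonal entries are nonpositive, and by the product formula
  the row of \<open>u B\<close> sums to \<open>- 2 * ln (cmod (\<tau> (u B)))\<close>, which is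
  positive. A relation between the dilation factors yields a unit \<open>w\<close> with
  \<open>\<nu> w = 1\<close>; its block logarithms vanish, which is a relation between the
  rows.\<close>

lemma rank_lower_bound:
  "\<exists>S\<subseteq>OT_dilation_factors F \<tau>. mult_indep S \<and> card S = card \<P>"
proof -
  obtain r where r: "\<And>B. B \<in> \<P> \<Longrightarrow> r B \<in> B" using block_nonempty by metis
  have rR: "r B \<in> R" if "B \<in> \<P>" for B using r[OF that] block_subset[OF that] by blast
  have "\<exists>u. B \<in> \<P> \<longrightarrow> u \<in> U \<and> (\<forall>\<sigma>\<in>E. \<sigma> \<noteq> r B \<longrightarrow> cmod (\<sigma> u) < 1)" for B
    using ex_unit_small_away[of "r B"] rR[of B] by metis
  then obtain u where u: "\<And>B. B \<in> \<P> \<Longrightarrow> u B \<in> U"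
    "\<And>B \<sigma>. B \<in> \<P> \<Longrightarrow> \<sigma> \<in> E \<Longrightarrow> \<sigma> \<noteq> r B \<Longrightarrow> cmod (\<sigma> (u B)) < 1" by metis
  define g where "g = (\<lambda>B. (cmod (\<tau> (u B)))\<^sup>2)"
  have ind: "\<forall>B\<in>\<P>. k B = 0" if "(\<Prod>B\<in>\<P>. g B powi k B) = 1" for k :: "_ \<Rightarrow> int"
  proof -
    define w where "w = (\<Prod>B\<in>\<P>. u B powi k B)"
    have w: "w \<in> U" unfolding w_def by (rule U_comb[OF u(1)])
    have "(cmod (\<tau> w))\<^sup>2 = (\<Prod>B\<in>\<P>. g B powi k B)"
      unfolding w_def g_def by (rule dilation_U_comb[OF u(1)])
    then have "cmod (\<tau> w) = 1" using that norm_ge_zero[of "\<tau> w"] by (auto simp: power2_eq_1_iff simp del: norm_ge_zero)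
    then have nu: "\<nu> w = 1" by (rule \<nu>_one[OF w])
    have col: "(\<Sum>B\<in>\<P>. of_int (k B) * block_log C (u B)) = 0" if C: "C \<in> \<P>" for C
    proof -
      have "block_log C w = ln (cmod (r C (\<nu> w)))" using block_log_\<nu>[OF w C r[OF C]] by simp
      also have "\<dots> = 0" using emb_one[OF real_emb[OF rR[OF C]]] by (simp add: nu)
      finally show ?thesis using block_log_comb[of \<P> u C k] u(1) C by (simp add: w_def)
    qed
    have "real_of_int (k B) = 0" if B: "B \<in> \<P>" for B
    proof (rule dominant_eq_0[where P=\<P> and a="\<lambda>B C. block_log C (u B)" and c="\<lambda>B. of_int (k B)"])
      fix B C assume BC: "B \<in> \<P>" "C \<in> \<P>" "B \<noteq> C"
      show "block_log C (u B) \<le> 0"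
        unfolding block_log_def
      proof (intro sum_nonpos)
        fix \<sigma> assume \<sigma>: "\<sigma> \<in> C"
        then have "\<sigma> \<in> E" using block_subset[OF BC(2)] R_subset by blast
        moreover have "\<sigma> \<noteq> r B" using \<sigma> r[OF BC(1)] disjoint[OF BC] by blast
        ultimately show "ln (cmod (\<sigma> (u B))) \<le> 0"
          using u(2)[OF BC(1)] U_cmod_pos[OF u(1)[OF BC(1)]] by (simp add: less_imp_le)
      qed
    next
      fix B assume B: "B \<in> \<P>"
      have "\<tau> \<noteq> r B" using rR[OF B] \<tau>_notin by auto
      then have t: "0 < cmod (\<tau> (u B))" "cmod (\<tau> (u B)) < 1"
        using u(2)[OF B \<tau>_E] U_cmod_pos[OF u(1)[OF B] \<tau>_E] by auto
      have nz: "cmod (\<sigma> (u B)) \<noteq> 0" if "\<sigma> \<in> R" for \<sigma>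
        using U_cmod_pos[OF u(1)[OF B] real_emb[OF that]] by simp
      have "(\<Sum>C\<in>\<P>. block_log C (u B)) = (\<Sum>\<sigma>\<in>R. ln (cmod (\<sigma> (u B))))"
        unfolding block_log_def by (rule sum_blocks)
      also have "\<dots> = ln (\<Prod>\<sigma>\<in>R. cmod (\<sigma> (u B)))" using nz by (intro ln_prod[symmetric]) auto
      also have "(\<Prod>\<sigma>\<in>R. cmod (\<sigma> (u B))) = 1 / (cmod (\<tau> (u B)))\<^sup>2"
        using U_product_formula[OF u(1)[OF B]] t by (simp add: field_simps)
      also have "ln \<dots> = - 2 * ln (cmod (\<tau> (u B)))"
        using t by (simp add: ln_div ln_realpow)
      also have "\<dots> > 0" using t by simp
      finally show "0 < (\<Sum>C\<in>\<P>. block_log C (u B))" .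
    qed (use col B in auto)
    then show ?thesis by simp
  qed
  have pos: "g B > 0" if "B \<in> \<P>" for B
    using U_cmod_pos[OF u(1)[OF that] \<tau>_E] by (simp add: g_def)
  have "mult_indep (g ` \<P>)" "card (g ` \<P>) = card \<P>"
    using mult_indep_image[OF finite_blocks pos ind] by auto
  moreover have "g ` \<P> \<subseteq> OT_dilation_factors F \<tau>"
    unfolding OT_dilation_factors_eq g_def using u(1) by blast
  ultimately show ?thesis by blast
qed

text \<open>Exponent vectors are sorted by the integer parts of the block logarithms of their units.
  Within one box, quotients have images under \<open>\<nu>\<close> in the finite set
  \<open>Bd\<close>; such an image determines the dilation factor, and by independence of
  \<open>S\<close> the exponents. So each box holds at most \<open>c\<close> vectors, and the growth
  in \<open>H\<close> bounds \<open>card S\<close>.\<close>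

lemma rank_upper_bound:
  assumes S: "S \<subseteq> OT_dilation_factors F \<tau>" "mult_indep S"
  shows "card S \<le> card \<P>"
proof (rule ccontr)
  assume "\<not> card S \<le> card \<P>"
  then have lt: "card \<P> + 1 \<le> card S" by simp
  have finS: "finite S" and ind: "\<And>k :: real \<Rightarrow> int. (\<Prod>x\<in>S. x powi k x) = 1 \<Longrightarrow> \<forall>x\<in>S. k x = 0"
    using S(2) by (simp_all add: mult_indep_def)
  have Spos: "x > 0" if "x \<in> S" for x using S(2) that by (simp add: mult_indep_def)
  have "\<exists>u. x \<in> S \<longrightarrow> u \<in> U \<and> x = (cmod (\<tau> u))\<^sup>2" for x
    using S(1) by (auto simp: OT_dilation_factors_eq)
  then obtain u where u: "\<And>x. x \<in> S \<Longrightarrow> u x \<in> U" "\<And>x. x \<in> S \<Longrightarrow> x = (cmod (\<tau> (u x)))\<^sup>2" by metis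
  define W where "W = (\<lambda>k. \<Prod>x\<in>S. u x powi k x)"
  have W: "W k \<in> U" for k unfolding W_def by (rule U_comb[OF u(1)])
  have W_dil: "(cmod (\<tau> (W k)))\<^sup>2 = (\<Prod>x\<in>S. x powi k x)" for k
  proof -
    have "(cmod (\<tau> (W k)))\<^sup>2 = (\<Prod>x\<in>S. ((cmod (\<tau> (u x)))\<^sup>2) powi k x)"
      unfolding W_def by (rule dilation_U_comb[OF u(1)])
    also have "\<dots> = (\<Prod>x\<in>S. x powi k x)" using u(2) by (intro prod.cong refl) metis
    finally show ?thesis .
  qed
  \<comment> \<open>By the product formula, conjugates of at least \<open>exp (- 1)\<close> at the
    real embeddings bound the square of the absolute value at \<open>\<tau>\<close> by
    \<open>exp 1 ^ n\<close>. The summand 1 serves to remove the square, through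
    \<open>x \<le> 1 + x * x\<close>.\<close>
  define K :: real where "K = 1 + exp 1 ^ n"
  define Bd where "Bd = {x \<in> OI. \<forall>\<sigma>\<in>E. cmod (\<sigma> x) \<le> K}"
  have finBd: "finite Bd" unfolding Bd_def by (rule finite_bounded_integers)
  have \<nu>_Bd: "\<nu> w \<in> Bd" if w: "w \<in> U" and small: "\<And>B. B \<in> \<P> \<Longrightarrow> \<bar>block_log B w\<bar> \<le> 1" for w
  proof -
    have bd: "cmod (\<sigma> (\<nu> w)) \<le> exp 1" "exp (- 1) \<le> cmod (\<sigma> (\<nu> w))" if \<sigma>: "\<sigma> \<in> R" for \<sigma>
    proof -
      obtain B where B: "B \<in> \<P>" "\<sigma> \<in> B" using \<sigma> blocks(1) by blast
      have "cmod (\<sigma> (\<nu> w)) = exp (block_log B w)"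
        using block_log_\<nu>[OF w B] U_cmod_pos[OF \<nu>_U[OF w] real_emb[OF \<sigma>]] by (metis exp_ln)
      moreover have "block_log B w \<le> 1" "- 1 \<le> block_log B w" using small[OF B(1)] by linarith+
      ultimately show "cmod (\<sigma> (\<nu> w)) \<le> exp 1" "exp (- 1) \<le> cmod (\<sigma> (\<nu> w))" by simp_all
    qed
    have "exp (- 1) ^ (n - 2) \<le> (\<Prod>\<sigma>\<in>R. cmod (\<sigma> (\<nu> w)))"
      using prod_mono[of R "\<lambda>_. exp (- 1) :: real" "\<lambda>\<sigma>. cmod (\<sigma> (\<nu> w))"] bd by (simp add: card_real)
    then have "(cmod (\<tau> (\<nu> w)))\<^sup>2 * exp (- 1) ^ (n - 2) \<le> (cmod (\<tau> (\<nu> w)))\<^sup>2 * (\<Prod>\<sigma>\<in>R. cmod (\<sigma> (\<nu> w)))"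
      by (intro mult_left_mono) auto
    also have "\<dots> = 1" by (rule U_product_formula[OF \<nu>_U[OF w]])
    finally have "(cmod (\<tau> (\<nu> w)))\<^sup>2 \<le> exp 1 ^ (n - 2)"
      by (simp add: exp_minus power_inverse field_simps)
    also have "\<dots> \<le> exp 1 ^ n" by (intro power_increasing) auto
    finally have "(cmod (\<tau> (\<nu> w)))\<^sup>2 \<le> exp 1 ^ n" .
    moreover have "0 \<le> (cmod (\<tau> (\<nu> w)) - 1 / 2)\<^sup>2" by simp
    then have "cmod (\<tau> (\<nu> w)) \<le> 1 + (cmod (\<tau> (\<nu> w)))\<^sup>2"
      by (simp add: power2_eq_square algebra_simps)
    ultimately have tK: "cmod (\<tau> (\<nu> w)) \<le> K" by (simp add: K_def)
    have "exp 1 ^ 1 \<le> exp (1::real) ^ n" using n_pos by (intro power_increasing) auto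
    then have eK: "exp 1 \<le> K" by (simp add: K_def)
    have "cmod (\<sigma> (\<nu> w)) \<le> K" if "\<sigma> \<in> E" for \<sigma>
      using that bd(1)[of \<sigma>] eK tK unfolding E_eq by fastforce
    then show ?thesis using U_OI[OF \<nu>_U[OF w]] by (simp add: Bd_def)
  qed
  define c where "c = card Bd"
  define M where "M = nat \<lceil>\<Sum>B\<in>\<P>. \<Sum>x\<in>S. \<bar>block_log B (u x)\<bar>\<rceil>"
  have M: "(\<Sum>x\<in>S. \<bar>block_log B (u x)\<bar>) \<le> real M" if "B \<in> \<P>" for B
  proof -
    have "(\<Sum>x\<in>S. \<bar>block_log B (u x)\<bar>) \<le> (\<Sum>B\<in>\<P>. \<Sum>x\<in>S. \<bar>block_log B (u x)\<bar>)"
      using that by (intro member_le_sum[where f="\<lambda>B. \<Sum>x\<in>S. \<bar>block_log B (u x)\<bar>"]) (auto intro: sum_nonneg)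
    also have "\<dots> \<le> real M" unfolding M_def by (rule real_nat_ceiling_ge)
    finally show ?thesis .
  qed
  have bl: "block_log B (W k) = (\<Sum>x\<in>S. of_int (k x) * block_log B (u x))" if "B \<in> \<P>" for B k
    unfolding W_def by (rule block_log_comb[OF finS u(1) that])
  have count: "(H + 1) ^ card S \<le> (2 * H * M + 1) ^ card \<P> * c" for H :: nat
  proof -
    define A where "A = PiE S (\<lambda>_. {0..int H})"
    define Y where "Y = PiE \<P> (\<lambda>_. {- int (H * M)..int (H * M)})"
    define g where "g = (\<lambda>k. restrict (\<lambda>B. \<lfloor>block_log B (W k)\<rfloor>) \<P>)"
    have A_mem: "k x \<in> {0..int H}" if "k \<in> A" "x \<in> S" for k x
      using PiE_mem[OF that(1)[unfolded A_def] that(2)] .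
    have finA: "finite A" unfolding A_def using finS by (intro finite_PiE) auto
    have finY: "finite Y" unfolding Y_def by (intro finite_PiE) auto
    have gY: "g k \<in> Y" if k: "k \<in> A" for k
      unfolding g_def Y_def
    proof (intro restrict_PiE_iff[THEN iffD2] ballI)
      fix B assume B: "B \<in> \<P>"
      have "\<bar>block_log B (W k)\<bar> \<le> (\<Sum>x\<in>S. \<bar>of_int (k x) * block_log B (u x)\<bar>)"
        unfolding bl[OF B] by (rule sum_abs)
      also have "\<dots> \<le> (\<Sum>x\<in>S. real H * \<bar>block_log B (u x)\<bar>)"
      proof (rule sum_mono)
        fix x assume "x \<in> S"
        then have "k x \<in> {0..int H}" by (rule A_mem[OF k])
        then have "\<bar>real_of_int (k x)\<bar> \<le> real H" by simp
        then show "\<bar>of_int (k x) * block_log B (u x)\<bar> \<le> real H * \<bar>block_log B (u x)\<bar>"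
          unfolding abs_mult by (rule mult_right_mono) simp
      qed
      also have "\<dots> \<le> real H * real M"
        unfolding sum_distrib_left[symmetric] by (intro mult_left_mono M[OF B]) simp
      finally have "\<bar>block_log B (W k)\<bar> \<le> real_of_int (int (H * M))" by simp
      then have "- real_of_int (int (H * M)) \<le> block_log B (W k)" "block_log B (W k) \<le> real_of_int (int (H * M))"
        by linarith+
      then show "\<lfloor>block_log B (W k)\<rfloor> \<in> {- int (H * M)..int (H * M)}"
        unfolding atLeastAtMost_iff by (intro conjI) (simp add: le_floor_iff, linarith)
    qed
    have "card {k \<in> A. g k = y} \<le> c" for y
    proof (cases "{k \<in> A. g k = y} = {}")
      case False
      then obtain k0 where k0: "k0 \<in> A" "g k0 = y" by blast
      \<comment> \<open>Subtracting the fixed vector \<open>k0\<close> of the box turns equal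
        integer parts into block logarithms of absolute value at most 1, as \<open>\<nu>_Bd\<close>
        demands.\<close>
      define f where "f = (\<lambda>k. \<nu> (W (\<lambda>x. k x - k0 x)))"
      have "f k \<in> Bd" if k: "k \<in> A" "g k = y" for k
        unfolding f_def
      proof (rule \<nu>_Bd[OF W])
        fix B assume B: "B \<in> \<P>"
        have "\<lfloor>block_log B (W k)\<rfloor> = \<lfloor>block_log B (W k0)\<rfloor>"
          using fun_cong[OF trans[OF k(2) k0(2)[symmetric]], of B] B by (simp add: g_def)
        then have "\<bar>block_log B (W k) - block_log B (W k0)\<bar> \<le> 1" by linarith
        moreover have "block_log B (W (\<lambda>x. k x - k0 x)) = block_log B (W k) - block_log B (W k0)"
          unfolding bl[OF B] by (simp add: left_diff_distrib sum_subtractf)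
        ultimately show "\<bar>block_log B (W (\<lambda>x. k x - k0 x))\<bar> \<le> 1" by simp
      qed
      then have "f ` {k \<in> A. g k = y} \<subseteq> Bd" by blast
      moreover have "inj_on f {k \<in> A. g k = y}"
      proof (rule inj_onI)
        fix k k' assume k: "k \<in> {k \<in> A. g k = y}" "k' \<in> {k \<in> A. g k = y}" "f k = f k'"
        define a where "a = (\<Prod>x\<in>S. x powi (k x - k0 x))"
        define a' where "a' = (\<Prod>x\<in>S. x powi (k' x - k0 x))"
        have "a = a'"
          unfolding a_def a'_def W_dil[symmetric]
          using \<nu>_determines[OF W W, of "\<lambda>x. k x - k0 x" "\<lambda>x. k' x - k0 x"] k(3) by (simp add: f_def)
        moreover have "a' \<noteq> 0" unfolding a'_def using finS Spos by (auto simp: power_int_eq_0_iff)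
        moreover have "(\<Prod>x\<in>S. x powi (k x - k' x)) = a / a'"
          unfolding a_def a'_def prod_dividef[symmetric]
        proof (intro prod.cong refl)
          fix x assume "x \<in> S"
          then have "x \<noteq> 0" using Spos by force
          then show "x powi (k x - k' x) = x powi (k x - k0 x) / x powi (k' x - k0 x)"
            using power_int_diff[of x "k x - k0 x" "k' x - k0 x"] by simp
        qed
        ultimately have "\<forall>x\<in>S. k x - k' x = 0" by (intro ind) simp
        then have "k x = k' x" if "x \<in> S" for x using that by simp
        then show "k = k'"
          using k(1,2) unfolding A_def by (intro PiE_ext[of k S _ k']) auto
      qed
      ultimately show ?thesis unfolding c_def using finBd by (intro card_inj_on_le[of f])
    next
      case True
      then show ?thesis by (simp only: card.empty)
    qed
    then have "card A \<le> card Y * c"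
      using gY finA finY by (intro card_le_mult_fibers[where g=g]) auto
    moreover have "card A = (H + 1) ^ card S"
      using finS by (simp add: A_def card_PiE nat_add_distrib)
    moreover have "card Y = (2 * H * M + 1) ^ card \<P>"
    proof -
      have "card {- int (H * M)..int (H * M)} = nat (int (2 * H * M + 1))" by (simp add: algebra_simps)
      then have "card {- int (H * M)..int (H * M)} = 2 * H * M + 1" by (simp only: nat_int)
      then show ?thesis by (simp only: Y_def card_PiE[OF finite_blocks] prod_constant)
    qed
    ultimately show ?thesis by simp
  qed
  \<comment> \<open>Since \<open>2 * H * M + 1 \<le> (2 * M + 1) * (H + 1)\<close>, this
    \<open>H\<close> turns the count into
    \<open>(H + 1) * (H + 1) ^ card \<P> \<le> H * (H + 1) ^ card \<P>\<close>.\<close>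
  define H where "H = (2 * M + 1) ^ card \<P> * c"
  have "(H + 1) * (H + 1) ^ card \<P> = (H + 1) ^ (card \<P> + 1)" by simp
  also have "\<dots> \<le> (H + 1) ^ card S" using lt by (intro power_increasing) auto
  also have "\<dots> \<le> (2 * H * M + 1) ^ card \<P> * c" by (rule count)
  also have "\<dots> \<le> ((2 * M + 1) * (H + 1)) ^ card \<P> * c"
    by (intro mult_right_mono power_mono) (auto simp: algebra_simps)
  also have "\<dots> = H * (H + 1) ^ card \<P>" by (simp only: H_def power_mult_distrib mult_ac)
  finally have "H + 1 \<le> H" by (simp only: mult_le_cancel2) simp
  then show False by simp
qed

theorem OT_rank: "OT_rank_is F \<tau> (card \<P>)"
  unfolding OT_rank_is_def has_mult_rank_def using rank_lower_bound rank_upper_bound by blast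

end

section \<open>Units with trivial dilation and quadratic subfields\<close>

interpretation rat_vs: vector_space "\<lambda>(q :: rat) (x :: complex). of_rat q * x"
  by unfold_locales (simp_all add: algebra_simps of_rat_add of_rat_mult)

lemma rat_independent_image:
  fixes f :: "'i \<Rightarrow> complex"
  assumes I: "finite I" and ind: "\<And>c :: 'i \<Rightarrow> rat. (\<Sum>i\<in>I. of_rat (c i) * f i) = 0 \<Longrightarrow> \<forall>i\<in>I. c i = 0"
  shows "inj_on f I" and "rat_vs.independent (f ` I)"
proof -
  show inj: "inj_on f I"
  proof (rule inj_onI, rule ccontr)
    fix i j assume ij: "i \<in> I" "j \<in> I" "f i = f j" "i \<noteq> j"
    define c :: "'i \<Rightarrow> rat" where "c = (\<lambda>l. if l = i then 1 else if l = j then -1 else 0)"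
    have "(\<Sum>l\<in>I. of_rat (c l) * f l) = of_rat (c i) * f i + (of_rat (c j) * f j + (\<Sum>l\<in>I - {i} - {j}. of_rat (c l) * f l))"
      using I ij by (subst sum.remove[of I i], simp_all) (subst sum.remove[of "I - {i}" j], simp_all)
    also have "(\<Sum>l\<in>I - {i} - {j}. of_rat (c l) * f l) = 0"
      by (intro sum.neutral) (auto simp: c_def)
    also have "of_rat (c i) * f i + (of_rat (c j) * f j + 0) = 0"
      using ij by (simp add: c_def)
    finally have "c i = 0" using ind ij(1) by blast
    then show False by (simp add: c_def)
  qed
  show "rat_vs.independent (f ` I)"
  proof
    assume "rat_vs.dependent (f ` I)"
    then obtain r :: "complex \<Rightarrow> rat" where r: "\<exists>v\<in>f ` I. r v \<noteq> 0" "(\<Sum>v\<in>f ` I. of_rat (r v) * v) = 0"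
      using rat_vs.dependent_finite[of "f ` I"] I by auto
    have "(\<Sum>i\<in>I. of_rat (r (f i)) * f i) = 0"
      using r(2) by (simp add: sum.reindex[OF inj])
    then show False using ind[of "\<lambda>i. r (f i)"] r(1) by blast
  qed
qed

text \<open>Translates a basis in the sense of spans into the coordinate form of
  \<open>field_degree\<close>. It serves to show that a subfield of \<open>F\<close> is a number
  field.\<close>

lemma field_degree_of_basis:
  assumes B: "finite B" "rat_vs.independent B" "B \<subseteq> K" "K \<subseteq> rat_vs.span B"
  shows "field_degree \<rat> K (card B)"
proof -
  obtain h where h: "bij_betw h {..<card B} B"
    using ex_bij_betw_nat_finite[OF B(1)] by (auto simp: atLeast0LessThan)
  have hB: "h i \<in> B" if "i < card B" for i using h that by (auto simp: bij_betw_def)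
  have inv: "inv_into {..<card B} h (h i) = i" if "i < card B" for i
    using h that by (simp add: bij_betw_def inv_into_f_f)
  show ?thesis
    unfolding field_degree_def
  proof (intro exI[of _ h] conjI allI impI ballI)
    fix i assume "i < card B"
    then show "h i \<in> K" using hB B(3) by blast
  next
    fix x assume x: "x \<in> K"
    have "x \<in> rat_vs.span B" using x B(4) by blast
    then obtain r :: "complex \<Rightarrow> rat" where r: "x = (\<Sum>v\<in>B. of_rat (r v) * v)"
      unfolding rat_vs.span_finite[OF B(1)] by blast
    show "\<exists>!c. (\<forall>i<card B. c i \<in> \<rat>) \<and> (\<forall>i\<ge>card B. c i = 0) \<and> x = (\<Sum>i<card B. c i * h i)"
    proof (rule ex1I)
      let ?c = "\<lambda>i. if i < card B then of_rat (r (h i)) else 0 :: complex"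
      have "x = (\<Sum>i<card B. of_rat (r (h i)) * h i)"
        unfolding r by (rule sum.reindex_bij_betw[OF h, symmetric])
      then show cx: "(\<forall>i<card B. ?c i \<in> \<rat>) \<and> (\<forall>i\<ge>card B. ?c i = 0) \<and> x = (\<Sum>i<card B. ?c i * h i)"
        by simp
      fix c :: "nat \<Rightarrow> complex"
      assume c: "(\<forall>i<card B. c i \<in> \<rat>) \<and> (\<forall>i\<ge>card B. c i = 0) \<and> x = (\<Sum>i<card B. c i * h i)"
      have "\<exists>q. i < card B \<longrightarrow> c i - ?c i = of_rat q" for i
        using c cx Rats_diff[of "c i" "?c i"] Rats_cases[of "c i - ?c i"] by metis
      then obtain q where q: "\<And>i. i < card B \<Longrightarrow> c i - ?c i = of_rat (q i)" by metis
      define s where "s = (\<lambda>v. q (inv_into {..<card B} h v))"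
      have "(\<Sum>v\<in>B. of_rat (s v) * v) = (\<Sum>i<card B. of_rat (s (h i)) * h i)"
        by (rule sum.reindex_bij_betw[OF h, symmetric])
      also have "\<dots> = (\<Sum>i<card B. (c i - ?c i) * h i)"
        using q inv by (intro sum.cong refl) (simp add: s_def)
      also have "\<dots> = (\<Sum>i<card B. c i * h i) - (\<Sum>i<card B. ?c i * h i)"
        by (simp only: left_diff_distrib sum_subtractf)
      also have "\<dots> = 0" using c cx by simp
      finally have "(\<Sum>v\<in>B. of_rat (s v) * v) = 0" .
      then have "s v = 0" if "v \<in> B" for v
        using B(1,2) rat_vs.dependent_finite[OF B(1)] that by blast
      then have "q i = 0" if "i < card B" for i using hB[OF that] inv[OF that] by (metis s_def)
      then have "c i = ?c i" if "i < card B" for i using q[OF that] that by simp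
      then show "c = ?c" using c by (intro ext) (metis leI)
    qed
  qed
qed

context OT_field
begin

lemma F_span: "F \<subseteq> rat_vs.span (b ` {..<n})"
proof
  fix x assume "x \<in> F"
  then obtain c :: "nat \<Rightarrow> rat" where x: "x = (\<Sum>i<n. of_rat (c i) * b i)" by (rule ex_coordinates)
  show "x \<in> rat_vs.span (b ` {..<n})"
    unfolding x by (intro rat_vs.span_sum rat_vs.span_scale rat_vs.span_base) simp
qed

lemma card_independent_le:
  assumes "rat_vs.independent B" "B \<subseteq> F"
  shows "finite B" and "card B \<le> n"
proof -
  have "finite B \<and> card B \<le> card (b ` {..<n})"
    by (rule rat_vs.independent_span_bound) (use assms F_span in auto)
  moreover have "card (b ` {..<n}) \<le> n" using card_image_le[of "{..<n}" b] by simp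
  ultimately show "finite B" "card B \<le> n" by auto
qed

text \<open>A rational relation between the powers below \<open>n\<close> is a polynomial of degree
  below \<open>n\<close> that vanishes at the \<open>n\<close> distinct conjugates of
  \<open>u\<close>. The powers are thus \<open>n\<close> independent elements of a space of
  dimension at most \<open>n\<close>.\<close>

lemma independent_powers_span:
  assumes u: "u \<in> F" and inj: "inj_on (\<lambda>\<sigma>. \<sigma> u) E"
  shows "F \<subseteq> rat_vs.span ((\<lambda>k. u ^ k) ` {..<n})"
proof
  fix x assume x: "x \<in> F"
  have ind: "\<forall>k\<in>{..<n}. c k = 0" if c: "(\<Sum>k<n. of_rat (c k) * u ^ k) = 0" for c :: "nat \<Rightarrow> rat"
  proof -
    define q where "q = (\<Sum>k<n. monom (of_rat (c k) :: complex) k)"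
    have "poly q (\<sigma> u) = 0" if \<sigma>: "\<sigma> \<in> E" for \<sigma>
    proof -
      have "poly q (\<sigma> u) = (\<Sum>k<n. \<sigma> (of_rat (c k) * u ^ k))"
        unfolding q_def poly_sum poly_monom using u
        by (intro sum.cong refl)
           (simp add: emb_mult[OF \<sigma>] emb_of_rat[OF \<sigma>] emb_power[OF \<sigma>] power_in)
      also have "\<dots> = \<sigma> (\<Sum>k<n. of_rat (c k) * u ^ k)"
        using u by (intro emb_sum[OF \<sigma>, symmetric] mult_in power_in) auto
      finally show ?thesis using c emb_zero[OF \<sigma>] by simp
    qed
    then have sub: "(\<lambda>\<sigma>. \<sigma> u) ` E \<subseteq> {z. poly q z = 0}" by blast
    have "degree q < n"
      unfolding q_def using n_pos
      by (intro degree_sum_less) (auto intro: le_less_trans[OF degree_monom_le])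
    have "q = 0"
    proof (rule ccontr)
      assume "q \<noteq> 0"
      then have "card {z. poly q z = 0} \<le> degree q" "finite {z. poly q z = 0}"
        by (rule poly_roots_degree, rule poly_roots_finite)
      moreover have "card ((\<lambda>\<sigma>. \<sigma> u) ` E) = n" using card_image[OF inj] card_embeddings by simp
      ultimately show False using card_mono[OF _ sub] \<open>degree q < n\<close> by simp
    qed
    show ?thesis
    proof
      fix k assume "k \<in> {..<n}"
      then have "coeff q k = of_rat (c k)" by (simp add: q_def coeff_sum)
      then show "c k = 0" using \<open>q = 0\<close> by simp
    qed
  qed
  let ?P = "(\<lambda>k. u ^ k) ` {..<n}"
  have P: "inj_on (\<lambda>k. u ^ k) {..<n}" "rat_vs.independent ?P"
    using rat_independent_image[of "{..<n}" "\<lambda>k. u ^ k"] ind by auto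
  show "x \<in> rat_vs.span ?P"
  proof (rule ccontr)
    assume nx: "x \<notin> rat_vs.span ?P"
    have "x \<notin> ?P" by (rule contrapos_nn[OF nx]) (rule rat_vs.span_base)
    then have "card (insert x ?P) = Suc n" using card_image[OF P(1)] by simp
    moreover have "rat_vs.independent (insert x ?P)"
      using P(2) nx by (rule rat_vs.independent_insertI[rotated])
    moreover have "insert x ?P \<subseteq> F" using x u by auto
    ultimately show False using card_independent_le(2) by fastforce
  qed
qed

definition conj_stable :: bool where
  "conj_stable \<longleftrightarrow> (\<forall>x\<in>F. \<exists>y\<in>F. \<tau> y = cnj (\<tau> x))"

text \<open>The multiplicity of \<open>\<sigma> u\<close> as a root of the characteristic polynomial of \<open>u\<close> does not depend
  on \<open>\<sigma>\<close>, and it is 1 for \<open>\<tau> u\<close>, which only \<open>\<tau>\<close> attains.\<close>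

lemma nonreal_conjugate_generates:
  assumes u: "u \<in> F" and nr: "\<tau> u \<notin> \<real>"
  shows "inj_on (\<lambda>\<sigma>. \<sigma> u) E"
proof (rule inj_onI, rule ccontr)
  fix \<sigma> \<rho> assume \<sigma>: "\<sigma> \<in> E" and \<rho>: "\<rho> \<in> E" and eq: "\<sigma> u = \<rho> u" and ne: "\<sigma> \<noteq> \<rho>"
  obtain p :: "rat poly" where p: "map_poly of_rat p = (\<Prod>\<sigma>\<in>E. [:- \<sigma> u, 1:])"
    using ex_characteristic_polynomial[OF u] .
  let ?P = "map_poly of_rat p :: complex poly"
  have P': "pderiv ?P = map_poly of_rat (pderiv p)" by (simp add: of_rat_hom.map_poly_pderiv)
  define f where "f = (\<lambda>\<sigma>. [:- \<sigma> u, 1 :: complex:])"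
  define Q where "Q = prod f (E - {\<sigma>} - {\<rho>})"
  have "prod f E = f \<sigma> * prod f (E - {\<sigma>})" using \<sigma> by (intro prod.remove) auto
  also have "prod f (E - {\<sigma>}) = f \<rho> * Q" unfolding Q_def using \<rho> ne by (intro prod.remove) auto
  finally have "?P = [:- \<sigma> u, 1:] * ([:- \<sigma> u, 1:] * Q)"
    unfolding p f_def eq .
  \<comment> \<open>A double root is a root of the derivative, which again has rational
    coefficients. Its vanishing therefore passes from \<open>\<sigma> u\<close> back to
    \<open>u\<close> and on to \<open>\<tau> u\<close>.\<close>
  then have "poly (pderiv ?P) (\<sigma> u) = 0" by (simp add: pderiv_mult del: mult_pCons_left)
  then have "\<sigma> (poly (map_poly of_rat (pderiv p)) u) = 0" by (simp add: P' emb_poly[OF \<sigma> u])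
  then have "poly (map_poly of_rat (pderiv p)) u = 0"
    using emb_eq_0_iff[OF \<sigma> poly_in[OF u]] by blast
  then have root: "poly (pderiv ?P) (\<tau> u) = 0"
    unfolding P' emb_poly[OF \<tau>_E u, symmetric] by (simp add: emb_zero[OF \<tau>_E])
  \<comment> \<open>At \<open>\<tau> u\<close> the derivative takes the value of the cofactor
    \<open>Q'\<close>, so a second embedding attains \<open>\<tau> u\<close>. A real embedding or
    \<open>\<tau>'\<close> could do so only if \<open>\<tau> u\<close> were real.\<close>
  define Q' where "Q' = (\<Prod>\<sigma>\<in>E - {\<tau>}. [:- \<sigma> u, 1:])"
  have "?P = [:- \<tau> u, 1:] * Q'" unfolding p Q'_def using \<tau>_E by (simp add: prod.remove del: mult_pCons_left)
  then have "poly Q' (\<tau> u) = 0" using root by (simp add: pderiv_mult pderiv_pCons del: mult_pCons_left)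
  then obtain \<sigma>' where \<sigma>': "\<sigma>' \<in> E - {\<tau>}" "\<tau> u = \<sigma>' u"
    by (auto simp: Q'_def poly_prod)
  then consider "\<sigma>' \<in> R" | "\<sigma>' = \<tau>'" using E_eq by blast
  then show False
  proof cases
    case 1
    then show ?thesis using real_val[of \<sigma>' u] \<sigma>'(2) nr by simp
  next
    case 2
    then show ?thesis using \<sigma>'(2) nr Reals_cnj_iff[of "\<tau> u"] by simp
  qed
qed

lemma kernel_imp_conj_stable:
  assumes u: "u \<in> U" "cmod (\<tau> u) = 1" "u \<noteq> 1"
  shows conj_stable
proof -
  have uF: "u \<in> F" using u(1) by (rule U_in)
  have cn: "\<tau> u * cnj (\<tau> u) = 1" using complex_norm_square[of "\<tau> u"] u(2) by simp
  \<comment> \<open>A real number of absolute value 1 is 1 or -1, and \<open>u = - 1\<close> is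
    negative at a real embedding, of which there is one because \<open>n > 2\<close>.\<close>
  have nr: "\<tau> u \<notin> \<real>"
  proof
    assume "\<tau> u \<in> \<real>"
    then have "(\<tau> u)\<^sup>2 = 1" using cn by (simp add: Reals_cnj_iff power2_eq_square)
    then have "\<tau> (u\<^sup>2) = \<tau> 1" by (simp add: emb_power[OF \<tau>_E uF] emb_one[OF \<tau>_E])
    then have "u\<^sup>2 = 1" using emb_eq_iff[OF \<tau>_E power_in[OF uF] one_in] by blast
    then have "u = - 1" using u(3) by (simp add: power2_eq_1_iff)
    moreover obtain \<sigma> where \<sigma>: "\<sigma> \<in> R" using R_nonempty by blast
    moreover have "\<sigma> (- 1) = - 1"
      using emb_uminus[OF real_emb[OF \<sigma>] one_in] emb_one[OF real_emb[OF \<sigma>]] by simp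
    ultimately show False using U_pos[OF u(1) \<sigma>] by simp
  qed
  \<comment> \<open>The elements whose conjugate under \<open>\<tau>\<close> stays in the image form
    a rational subspace. It contains every power of \<open>u\<close>, with
    \<open>inverse u ^ k\<close> as witness, and these powers span \<open>F\<close>.\<close>
  define T where "T = {x \<in> F. \<exists>y\<in>F. \<tau> y = cnj (\<tau> x)}"
  have "rat_vs.subspace T"
  proof (rule rat_vs.subspaceI)
    show "0 \<in> T" by (auto simp: T_def emb_zero[OF \<tau>_E] intro!: bexI[of _ 0])
  next
    fix x y assume "x \<in> T" "y \<in> T"
    then obtain x' y' where *: "x \<in> F" "y \<in> F" "x' \<in> F" "y' \<in> F" "\<tau> x' = cnj (\<tau> x)" "\<tau> y' = cnj (\<tau> y)"
      by (auto simp: T_def)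
    then have "\<tau> (x' + y') = cnj (\<tau> (x + y))" by (simp add: emb_add[OF \<tau>_E])
    then show "x + y \<in> T" using * by (auto simp: T_def)
  next
    fix q :: rat and x assume "x \<in> T"
    then obtain x' where *: "x \<in> F" "x' \<in> F" "\<tau> x' = cnj (\<tau> x)" by (auto simp: T_def)
    have "cnj (of_rat q) = of_rat q" by (cases q) (simp add: of_rat_rat)
    then have "\<tau> (of_rat q * x') = cnj (\<tau> (of_rat q * x))"
      using * by (simp add: emb_mult[OF \<tau>_E] emb_of_rat[OF \<tau>_E])
    moreover have "of_rat q * x \<in> F" "of_rat q * x' \<in> F" using * by auto
    ultimately show "of_rat q * x \<in> T" unfolding T_def by blast
  qed
  moreover have "(\<lambda>k. u ^ k) ` {..<n} \<subseteq> T"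
  proof
    fix x assume "x \<in> (\<lambda>k. u ^ k) ` {..<n}"
    then obtain k where k: "x = u ^ k" by blast
    have "inverse (\<tau> u) = cnj (\<tau> u)" using cn by (rule inverse_unique)
    then have "\<tau> (inverse u ^ k) = cnj (\<tau> (u ^ k))"
      by (simp add: emb_power[OF \<tau>_E] uF inverse_in emb_inverse[OF \<tau>_E])
    moreover have "u ^ k \<in> F" "inverse u ^ k \<in> F" using uF by auto
    ultimately show "x \<in> T" unfolding T_def k by blast
  qed
  ultimately have "rat_vs.span ((\<lambda>k. u ^ k) ` {..<n}) \<subseteq> T" by (intro rat_vs.span_minimal)
  then have "F \<subseteq> T"
    using independent_powers_span[OF uF nonreal_conjugate_generates[OF uF nr]] by blast
  then show ?thesis by (auto simp: conj_stable_def T_def)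
qed

lemma rank_trivial_kernel:
  assumes triv: "\<And>u. u \<in> U \<Longrightarrow> cmod (\<tau> u) = 1 \<Longrightarrow> u = 1"
  shows "OT_rank_is F \<tau> (n - 2)"
proof -
  interpret OT_blocks F n b \<tau> "(\<lambda>\<sigma>. {\<sigma>}) ` R" "\<lambda>w. w"
    by unfold_locales (use triv in auto)
  have "card ((\<lambda>\<sigma>. {\<sigma>}) ` R) = n - 2"
    using card_real by (subst card_image) (auto simp: inj_on_def)
  then show ?thesis using OT_rank by simp
qed

lemma inj_on_dilation:
  assumes triv: "\<And>u. u \<in> U \<Longrightarrow> cmod (\<tau> u) = 1 \<Longrightarrow> u = 1"
  shows "inj_on (\<lambda>u. (cmod (\<tau> u))\<^sup>2) U"
proof (rule inj_onI)
  fix u v assume uv: "u \<in> U" "v \<in> U" "(cmod (\<tau> u))\<^sup>2 = (cmod (\<tau> v))\<^sup>2"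
  have "cmod (\<tau> u) = cmod (\<tau> v)" using uv(3) by simp
  moreover have "cmod (\<tau> v) > 0" using U_cmod_pos[OF uv(2) \<tau>_E] .
  moreover have "\<tau> (u * inverse v) = \<tau> u * inverse (\<tau> v)"
    using U_in[OF uv(1)] U_in[OF uv(2)]
    by (simp add: emb_mult[OF \<tau>_E] emb_inverse[OF \<tau>_E] inverse_in)
  ultimately have "cmod (\<tau> (u * inverse v)) = 1"
    by (simp add: norm_mult norm_inverse)
  then have "u * inverse v = 1" by (rule triv[OF U_mult[OF uv(1) U_inverse[OF uv(2)]]])
  then show "u = v" using U_nonzero[OF uv(2)] by (simp add: field_simps)
qed

lemma rank_conj_stable:
  assumes conj_stable
  shows "even n" and "OT_rank_is F \<tau> ((n - 2) div 2)"
proof -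
  have "\<forall>x. \<exists>y. (x \<in> F \<longrightarrow> y \<in> F \<and> \<tau> y = cnj (\<tau> x)) \<and> (x \<notin> F \<longrightarrow> y = 0)"
    using assms by (auto simp: conj_stable_def)
  then obtain \<iota> where \<iota>: "\<And>x. x \<in> F \<Longrightarrow> \<iota> x \<in> F" "\<And>x. x \<in> F \<Longrightarrow> \<tau> (\<iota> x) = cnj (\<tau> x)"
    "\<And>x. x \<notin> F \<Longrightarrow> \<iota> x = 0" by metis
  \<comment> \<open>Every identity for \<open>\<iota>\<close> is verified after applying the
    injective map \<open>\<tau>\<close>, where \<open>\<iota>\<close> becomes complex
    conjugation.\<close>
  have \<tau>_cancel: "x = y" if "\<tau> x = \<tau> y" "x \<in> F" "y \<in> F" for x y
    using emb_eq_iff[OF \<tau>_E that(2,3)] that(1) by simp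
  have \<iota>_add: "\<iota> (x + y) = \<iota> x + \<iota> y" if "x \<in> F" "y \<in> F" for x y
    by (rule \<tau>_cancel) (use that in \<open>auto simp: \<iota> emb_add[OF \<tau>_E] add_in\<close>)
  have \<iota>_mult: "\<iota> (x * y) = \<iota> x * \<iota> y" if "x \<in> F" "y \<in> F" for x y
    by (rule \<tau>_cancel) (use that in \<open>auto simp: \<iota> emb_mult[OF \<tau>_E] mult_in\<close>)
  have \<iota>_one: "\<iota> 1 = 1"
    by (rule \<tau>_cancel) (auto simp: \<iota> emb_one[OF \<tau>_E])
  have \<iota>\<iota>: "\<iota> (\<iota> x) = x" if "x \<in> F" for x
    by (rule \<tau>_cancel) (use that in \<open>auto simp: \<iota>\<close>)
  have \<iota>_E: "\<iota> \<in> E" by (auto simp: embeddings_def \<iota>_add \<iota>_mult \<iota>_one \<iota>(3))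
  have comp_E: "\<sigma> \<circ> \<iota> \<in> E" if \<sigma>: "\<sigma> \<in> E" for \<sigma>
    by (auto simp: embeddings_def \<iota>_add \<iota>_mult \<iota>_one \<iota> emb_add[OF \<sigma>] emb_mult[OF \<sigma>] emb_one[OF \<sigma>] emb_zero[OF \<sigma>])
  have comp_R: "\<sigma> \<circ> \<iota> \<in> R" if \<sigma>: "\<sigma> \<in> R" for \<sigma>
    using comp_E[OF real_emb[OF \<sigma>]] real_val[OF \<sigma>] by (auto simp: real_embeddings_def)
  have comp_comp: "\<sigma> \<circ> \<iota> \<circ> \<iota> = \<sigma>" if \<sigma>: "\<sigma> \<in> E" for \<sigma>
    by (rule emb_eqI) (use \<sigma> comp_E \<iota>\<iota> in auto)
  \<comment> \<open>Each block thus has exactly two elements. An embedding fixed by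
    \<open>\<iota>\<close> would, being injective, force \<open>\<iota>\<close> to be the identity,
    although \<open>\<tau>\<close> has nonreal values.\<close>
  have comp_neq: "\<sigma> \<circ> \<iota> \<noteq> \<sigma>" if \<sigma>: "\<sigma> \<in> E" for \<sigma>
  proof
    assume eq: "\<sigma> \<circ> \<iota> = \<sigma>"
    obtain x where x: "x \<in> F" "\<tau> x \<notin> \<real>" by (rule ex_nonreal)
    have "\<sigma> (\<iota> x) = \<sigma> x" using fun_cong[OF eq, of x] by simp
    then have "\<iota> x = x" using emb_eq_iff[OF \<sigma> \<iota>(1)[OF x(1)] x(1)] by simp
    then show False using \<iota>(2)[OF x(1)] x(2) Reals_cnj_iff by simp
  qed
  define \<P> where "\<P> = (\<lambda>\<sigma>. {\<sigma>, \<sigma> \<circ> \<iota>}) ` R"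
  define \<nu> where "\<nu> = (\<lambda>w. w * \<iota> w)"
  have disj: "B \<inter> C = {}" if BC: "B \<in> \<P>" "C \<in> \<P>" "B \<noteq> C" for B C
  proof (rule ccontr)
    assume "B \<inter> C \<noteq> {}"
    moreover obtain \<sigma> \<rho> where *: "\<sigma> \<in> R" "B = {\<sigma>, \<sigma> \<circ> \<iota>}" "\<rho> \<in> R" "C = {\<rho>, \<rho> \<circ> \<iota>}"
      using BC(1,2) by (auto simp: \<P>_def)
    ultimately consider "\<sigma> = \<rho>" | "\<sigma> = \<rho> \<circ> \<iota>" | "\<sigma> \<circ> \<iota> = \<rho>" | "\<sigma> \<circ> \<iota> = \<rho> \<circ> \<iota>" by blast
    then have "B = C"
    proof cases
      case 1
      then show ?thesis using * by simp
    next
      case 2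
      then show ?thesis using * comp_comp[OF real_emb[OF *(3)]] by auto
    next
      case 3
      then show ?thesis using * comp_comp[OF real_emb[OF *(1)]] by auto
    next
      case 4
      then have "\<sigma> = \<rho>" using comp_comp[OF real_emb[OF *(1)]] comp_comp[OF real_emb[OF *(3)]] by metis
      then show ?thesis using * by simp
    qed
    then show False using BC(3) by simp
  qed
  \<comment> \<open>The relative norm and the dilation factor determine each other, since
    \<open>\<tau>\<close> is injective. Both conditions linking \<open>\<nu>\<close> to
    \<open>\<tau>\<close> in the locale follow from this.\<close>
  have \<nu>_\<tau>: "\<tau> (\<nu> w) = of_real ((cmod (\<tau> w))\<^sup>2)" if "w \<in> F" for w
    using that complex_norm_square[of "\<tau> w"] by (simp add: \<nu>_def emb_mult[OF \<tau>_E] \<iota>)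
  have union: "\<Union>\<P> = R" using comp_R by (auto simp: \<P>_def)
  have \<iota>_U: "\<iota> w \<in> U" if w: "w \<in> U" for w
  proof (rule UI)
    have wF: "w \<in> F" "inverse w \<in> F" using U_in[OF w] by auto
    have "algebraic_integer (\<iota> w)"
      by (rule emb_algebraic_integer[OF \<iota>_E OI_integer[OF U_OI[OF w]] wF(1)])
    then show "\<iota> w \<in> OI" using \<iota>(1)[OF wF(1)] by (simp add: ring_of_integers_def)
    have "algebraic_integer (\<iota> (inverse w))"
      by (rule emb_algebraic_integer[OF \<iota>_E OI_integer[OF U_inverse_OI[OF w]] wF(2)])
    then show "inverse (\<iota> w) \<in> OI"
      using \<iota>(1)[OF wF(2)] by (simp add: ring_of_integers_def emb_inverse[OF \<iota>_E wF(1)])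
    show "\<iota> w \<noteq> 0" using emb_eq_0_iff[OF \<iota>_E wF(1)] U_nonzero[OF w] by simp
    show "0 < Re (\<sigma> (\<iota> w))" if "\<sigma> \<in> R" for \<sigma> using U_pos[OF w comp_R[OF that]] by simp
  qed
  have blocks: "OT_blocks F n b \<tau> \<P> \<nu>"
  proof unfold_locales
    show "\<Union>\<P> = R" by (rule union)
    show "{} \<notin> \<P>" by (auto simp: \<P>_def)
    show "B \<inter> C = {}" if "B \<in> \<P>" "C \<in> \<P>" "B \<noteq> C" for B C using disj that .
  next
    fix w assume w: "w \<in> U"
    then show "\<nu> w \<in> U" using \<iota>_U unfolding \<nu>_def by (intro U_mult)
    fix B \<sigma> assume B: "B \<in> \<P>" "\<sigma> \<in> B"
    have wF: "w \<in> F" using U_in[OF w] .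
    obtain \<rho> where \<rho>: "\<rho> \<in> R" "B = {\<rho>, \<rho> \<circ> \<iota>}" using B(1) by (auto simp: \<P>_def)
    have \<rho>E: "\<rho> \<in> E" using real_emb[OF \<rho>(1)] .
    have \<sigma>E: "\<sigma> \<in> E" using B(2) \<rho>(2) \<rho>E comp_E by auto
    have "cmod (\<sigma> (\<nu> w)) = cmod (\<sigma> w) * cmod (\<sigma> (\<iota> w))"
      using wF by (simp add: \<nu>_def emb_mult[OF \<sigma>E] \<iota>(1) norm_mult)
    also have "\<dots> = cmod (\<rho> w) * cmod (\<rho> (\<iota> w))"
      using B(2) \<rho>(2) \<iota>\<iota>[OF wF] by auto
    also have "\<dots> = (\<Prod>\<rho>\<in>B. cmod (\<rho> w))"
      using comp_neq[OF \<rho>E] by (simp add: \<rho>(2) eq_commute)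
    finally show "cmod (\<sigma> (\<nu> w)) = (\<Prod>\<rho>\<in>B. cmod (\<rho> w))" .
  next
    fix w assume w: "w \<in> U" "cmod (\<tau> w) = 1"
    have wF: "w \<in> F" using U_in[OF w(1)] .
    have "\<tau> (\<nu> w) = \<tau> 1" using \<nu>_\<tau>[OF wF] w(2) by (simp add: emb_one[OF \<tau>_E])
    then show "\<nu> w = 1" by (rule \<tau>_cancel) (use wF \<iota>(1) in \<open>auto simp: \<nu>_def\<close>)
  next
    fix w w' assume w: "w \<in> U" "w' \<in> U" "\<nu> w = \<nu> w'"
    then have "complex_of_real ((cmod (\<tau> w))\<^sup>2) = of_real ((cmod (\<tau> w'))\<^sup>2)"
      using \<nu>_\<tau>[OF U_in[OF w(1)]] \<nu>_\<tau>[OF U_in[OF w(2)]] by simp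
    then have "(cmod (\<tau> w))\<^sup>2 = (cmod (\<tau> w'))\<^sup>2" by (simp only: of_real_eq_iff)
    then show "cmod (\<tau> w) = cmod (\<tau> w')" by simp
  qed
  have "2 * card \<P> = card (\<Union>\<P>)"
  proof (rule card_partition)
    show "finite \<P>" by (simp add: \<P>_def)
    show "finite (\<Union>\<P>)" by (simp add: union)
    show "card B = 2" if "B \<in> \<P>" for B
      using that comp_neq[OF real_emb] by (auto simp: \<P>_def card_insert_if eq_commute)
    show "B \<inter> C = {}" if "B \<in> \<P>" "C \<in> \<P>" "B \<noteq> C" for B C using disj that .
  qed
  then have card: "2 * card \<P> = n - 2" by (simp add: union card_real)
  then have "n = 2 * card \<P> + 2" using n_gt_2 by simp
  then show "even n" by simp
  show "OT_rank_is F \<tau> ((n - 2) div 2)"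
    using OT_blocks.OT_rank[OF blocks] card[symmetric] by simp
qed

text \<open>The field is the preimage of the reals under \<open>\<tau>\<close>. An embedding of it
  sends \<open>x\<close> to a root of the characteristic polynomial of \<open>x\<close> on
  \<open>F\<close>, that is, to some \<open>\<sigma> x\<close>; this is real for real
  \<open>\<sigma>\<close>, and for the other two because \<open>\<tau> x\<close> is real. A basis of
  \<open>F\<close> over it is 1 and any \<open>\<theta>\<close> with nonreal image.\<close>

lemma conj_stable_imp_quadratic:
  assumes conj_stable
  shows "\<exists>K. number_field K \<and> K \<subseteq> F \<and> totally_real K \<and> field_degree K F 2"
proof -
  define K where "K = {x \<in> F. \<tau> x \<in> \<real>}"
  have KF: "K \<subseteq> F" by (auto simp: K_def)
  have subK: "is_subfield K"
    by (auto simp: is_subfield_def K_def emb_zero[OF \<tau>_E] emb_one[OF \<tau>_E] emb_add[OF \<tau>_E]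
        emb_mult[OF \<tau>_E] emb_uminus[OF \<tau>_E] emb_inverse[OF \<tau>_E])
  interpret K: subfield_of_complex K by unfold_locales (rule subK)
  obtain B where B: "B \<subseteq> K" "rat_vs.independent B" "K \<subseteq> rat_vs.span B"
    using rat_vs.maximal_independent_subset[of K] by blast
  have "finite B" using card_independent_le(1)[OF B(2)] B(1) KF by blast
  then have "field_degree \<rat> K (card B)" using B by (intro field_degree_of_basis)
  then have nf: "number_field K" using subK by (auto simp: number_field_def)
  have "totally_real K"
    unfolding totally_real_def
  proof
    show "embeddings K \<subseteq> real_embeddings K"
    proof
      fix \<rho> assume \<rho>: "\<rho> \<in> embeddings K"
      have "\<rho> x \<in> \<real>" if x: "x \<in> K" for x
      proof -
        have xF: "x \<in> F" using x KF by blast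
        obtain p :: "rat poly" where p: "map_poly of_rat p = (\<Prod>\<sigma>\<in>E. [:- \<sigma> x, 1:])"
          using ex_characteristic_polynomial[OF xF] .
        have "poly (map_poly of_rat p) x = 0"
          unfolding p poly_prod using id_embedding xF
          by (intro prod_zero bexI[of _ "\<lambda>x. if x \<in> F then x else 0"]) auto
        then have "poly (map_poly of_rat p) (\<rho> x) = 0"
          using K.emb_poly[OF \<rho> x, of p] K.emb_zero[OF \<rho>] by simp
        then obtain \<sigma> where "\<sigma> \<in> E" "\<rho> x = \<sigma> x" by (auto simp: p poly_prod)
        then show ?thesis using x real_val[of \<sigma> x] Reals_cnj_iff[of "\<tau> x"]
          by (auto simp: E_eq K_def)
      qed
      then show "\<rho> \<in> real_embeddings K" using \<rho> by (auto simp: real_embeddings_def)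
    qed
  qed (auto simp: real_embeddings_def)
  moreover have "field_degree K F 2"
  proof -
    obtain \<theta> where \<theta>: "\<theta> \<in> F" "\<tau> \<theta> \<notin> \<real>" by (rule ex_nonreal)
    have Im\<theta>: "Im (\<tau> \<theta>) \<noteq> 0" using \<theta>(2) by (simp add: complex_is_Real_iff)
    show ?thesis
      unfolding field_degree_def
    proof (intro exI[of _ "\<lambda>i. if i = (0 :: nat) then 1 else \<theta>"] conjI allI impI ballI)
      fix x assume x: "x \<in> F"
      obtain x' where x': "x' \<in> F" "\<tau> x' = cnj (\<tau> x)" using assms x by (auto simp: conj_stable_def)
      obtain \<theta>' where \<theta>': "\<theta>' \<in> F" "\<tau> \<theta>' = cnj (\<tau> \<theta>)" using assms \<theta> by (auto simp: conj_stable_def)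
      \<comment> \<open>Subtracting the conjugate equation \<open>x' = c0 + c1 * \<theta>'\<close>
        from \<open>x = c0 + c1 * \<theta>\<close> eliminates \<open>c0\<close>.\<close>
      define c1 where "c1 = (x - x') / (\<theta> - \<theta>')"
      define c0 where "c0 = x - c1 * \<theta>"
      have F: "c1 \<in> F" "c0 \<in> F" using x x' \<theta> \<theta>' by (auto simp: c1_def c0_def)
      have t1: "\<tau> c1 = of_real (Im (\<tau> x) / Im (\<tau> \<theta>))"
      proof -
        have "\<tau> c1 = (\<tau> x - cnj (\<tau> x)) / (\<tau> \<theta> - cnj (\<tau> \<theta>))"
          using x x' \<theta> \<theta>' by (simp add: c1_def emb_divide[OF \<tau>_E] emb_diff[OF \<tau>_E] diff_in)
        also have "\<tau> x - cnj (\<tau> x) = of_real (2 * Im (\<tau> x)) * \<i>" by (simp add: complex_eq_iff)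
        also have "\<tau> \<theta> - cnj (\<tau> \<theta>) = of_real (2 * Im (\<tau> \<theta>)) * \<i>" by (simp add: complex_eq_iff)
        finally show ?thesis using Im\<theta> by simp
      qed
      have t0: "\<tau> c0 = \<tau> x - \<tau> c1 * \<tau> \<theta>"
        using x F \<theta> by (simp add: c0_def emb_diff[OF \<tau>_E] emb_mult[OF \<tau>_E] mult_in)
      have "Im (\<tau> c0) = 0" using Im\<theta> by (simp add: t0 t1)
      then have cK: "c0 \<in> K" "c1 \<in> K" using F t1 by (simp_all add: K_def complex_is_Real_iff)
      show "\<exists>!c :: nat \<Rightarrow> complex. (\<forall>i<2. c i \<in> K) \<and> (\<forall>i\<ge>2. c i = 0) \<and> x = (\<Sum>i<2. c i * (if i = 0 then 1 else \<theta>))"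
      proof (rule ex1I[of _ "\<lambda>i. if i = (0 :: nat) then c0 else if i = 1 then c1 else 0"], goal_cases)
        case 1
        show ?case using cK by (auto simp: numeral_2_eq_2 c0_def)
      next
        case (2 c)
        then have c: "c 0 \<in> K" "c 1 \<in> K" "x = c 0 + c 1 * \<theta>" "\<And>i. i \<ge> 2 \<Longrightarrow> c i = 0"
          by (auto simp: numeral_2_eq_2)
        have cF: "c 0 \<in> F" "c 1 \<in> F" and real: "Im (\<tau> (c 0)) = 0" "Im (\<tau> (c 1)) = 0"
          using c(1,2) by (auto simp: K_def complex_is_Real_iff)
        have "\<tau> x = \<tau> (c 0) + \<tau> (c 1) * \<tau> \<theta>"
          unfolding c(3) using cF \<theta> by (simp add: emb_add[OF \<tau>_E] emb_mult[OF \<tau>_E] mult_in)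
        then have "Im (\<tau> x) = Re (\<tau> (c 1)) * Im (\<tau> \<theta>)" using real by simp
        then have "\<tau> (c 1) = \<tau> c1" using real Im\<theta> by (simp add: t1 complex_eq_iff)
        then have "c 1 = c1" using emb_eq_iff[OF \<tau>_E cF(2) F(1)] by simp
        then show ?case using c by (auto simp: fun_eq_iff c0_def)
      qed
    qed (use \<theta> in auto)
  qed
  ultimately show ?thesis using nf KF by blast
qed

text \<open>Over \<open>K\<close> the elements 1, \<open>x\<close> and the square of
  \<open>x\<close> are dependent, so \<open>x\<close> satisfies a quadratic equation with
  coefficients in \<open>K\<close>. If \<open>\<tau> x\<close> is not real, its conjugate is the
  image of the other root.\<close>

lemma quadratic_imp_conj_stable:
  assumes K: "number_field K" "K \<subseteq> F" "totally_real K" "field_degree K F 2"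
  shows conj_stable
  unfolding conj_stable_def
proof
  interpret K: subfield_of_complex K
    using K(1) by unfold_locales (simp add: number_field_def)
  have \<tau>K: "\<tau> y \<in> \<real>" if y: "y \<in> K" for y
  proof -
    have "(\<lambda>y. if y \<in> K then \<tau> y else 0) \<in> embeddings K"
      using K(2) by (auto simp: embeddings_def emb_add[OF \<tau>_E] emb_mult[OF \<tau>_E] emb_one[OF \<tau>_E] subset_iff)
    then have "(\<lambda>y. if y \<in> K then \<tau> y else 0) \<in> real_embeddings K"
      using K(3) by (simp only: totally_real_def)
    then have "(\<lambda>y. if y \<in> K then \<tau> y else 0) ` K \<subseteq> \<real>"
      unfolding real_embeddings_def by blast
    then have "(if y \<in> K then \<tau> y else 0) \<in> \<real>" using y by blast
    then show ?thesis using y by simp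
  qed
  obtain e where e: "\<forall>x\<in>F. \<exists>!c :: nat \<Rightarrow> complex. (\<forall>i<2. c i \<in> K) \<and> (\<forall>i\<ge>2. c i = 0) \<and>
      x = (\<Sum>i<2. c i * e i)"
    using K(4) unfolding field_degree_def by (elim exE conjE) (rule that)
  have coords: "\<exists>a\<in>K. \<exists>d\<in>K. x = a * e 0 + d * e 1" if xF: "x \<in> F" for x
  proof -
    obtain c :: "nat \<Rightarrow> complex" where "\<forall>i<2. c i \<in> K" "x = (\<Sum>i<2. c i * e i)"
      using ex1_implies_ex[OF bspec[OF e xF]] by (elim exE conjE) (rule that)
    then show ?thesis by (intro bexI[of _ "c 0"] bexI[of _ "c 1"]) (simp_all add: numeral_2_eq_2)
  qed
  fix x assume x: "x \<in> F"
  obtain p0 p1 where p: "p0 \<in> K" "p1 \<in> K" "1 = p0 * e 0 + p1 * e 1" using coords[OF one_in] by blast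
  obtain q0 q1 where q: "q0 \<in> K" "q1 \<in> K" "x = q0 * e 0 + q1 * e 1" using coords[OF x] by blast
  obtain r0 r1 where r: "r0 \<in> K" "r1 \<in> K" "x\<^sup>2 = r0 * e 0 + r1 * e 1" using coords[OF power_in[OF x]] by blast
  \<comment> \<open>The coefficients of the relation are the 2 by 2 minors of the coordinates of 1,
    \<open>x\<close> and the square of \<open>x\<close>.\<close>
  define A where "A = q0 * r1 - q1 * r0"
  define B where "B = r0 * p1 - r1 * p0"
  define D where "D = p0 * q1 - p1 * q0"
  have ABD: "A \<in> K" "B \<in> K" "D \<in> K" using p q r by (auto simp: A_def B_def D_def)
  have "A * (p0 * e 0 + p1 * e 1) + B * (q0 * e 0 + q1 * e 1) + D * (r0 * e 0 + r1 * e 1) = 0"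
    by (simp add: A_def B_def D_def algebra_simps)
  then have rel: "A + B * x + D * x\<^sup>2 = 0" unfolding p(3)[symmetric] q(3)[symmetric] r(3)[symmetric] by simp
  show "\<exists>y\<in>F. \<tau> y = cnj (\<tau> x)"
  proof (cases "\<tau> x \<in> \<real>")
    case True
    then show ?thesis using x Reals_cnj_iff by metis
  next
    case False
    \<comment> \<open>If \<open>D\<close> vanished, the coordinates of \<open>x\<close> would be
      proportional to those of 1, so \<open>x\<close> would lie in \<open>K\<close> and
      \<open>\<tau> x\<close> would be real.\<close>
    have "D \<noteq> 0"
    proof
      assume "D = 0"
      then have d: "p0 * q1 = p1 * q0" by (simp add: D_def)
      have "p0 * x = q0 * (p0 * e 0 + p1 * e 1)" unfolding q(3) using d by (simp add: algebra_simps)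
      then have "p0 * x = q0" using p(3) by simp
      moreover have "p1 * x = q1 * (p0 * e 0 + p1 * e 1)" unfolding q(3) using d by (simp add: algebra_simps)
      then have "p1 * x = q1" using p(3) by simp
      moreover have "p0 \<noteq> 0 \<or> p1 \<noteq> 0" using p(3) by auto
      ultimately have "x = q0 / p0 \<and> p0 \<noteq> 0 \<or> x = q1 / p1 \<and> p1 \<noteq> 0" by (auto simp: field_simps)
      then have "x \<in> K" using p q by auto
      then show False using \<tau>K False by blast
    qed
    \<comment> \<open>The sum of the two roots, so that \<open>a - x\<close> is the other root and
      \<open>x * (a - x) = A / D\<close> lies in \<open>K\<close>. Since \<open>\<tau>\<close> is
      real on \<open>K\<close>, the sum and the product of \<open>\<tau> x\<close> and
      \<open>\<tau> (a - x)\<close> are real, which makes them conjugate.\<close>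
    define a where "a = - B / D"
    have aK: "a \<in> K" and aF: "a \<in> F" using ABD K(2) by (auto simp: a_def)
    have AD: "- A / D \<in> K" using ABD by auto
    have "D * (x * (a - x)) = - (B * x) - D * x\<^sup>2"
      using \<open>D \<noteq> 0\<close> by (simp add: a_def field_simps power2_eq_square)
    also have "\<dots> = A - (A + B * x + D * x\<^sup>2)" by simp
    also have "\<dots> = A" unfolding rel by simp
    finally have "x * (a - x) = A / D" using \<open>D \<noteq> 0\<close> by (simp add: field_simps)
    then have "- (x * (a - x)) \<in> K" using AD by simp
    moreover have "x * (a - x) \<in> F" using x aF by auto
    ultimately have "\<tau> (x * (a - x)) \<in> \<real>" using \<tau>K[of "- (x * (a - x))"] by (simp add: emb_uminus[OF \<tau>_E])
    then have "\<tau> x * (\<tau> a - \<tau> x) \<in> \<real>" using x aF by (simp add: emb_mult[OF \<tau>_E] emb_diff[OF \<tau>_E] diff_in)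
    then have "Im (\<tau> x * (\<tau> a - \<tau> x)) = 0" by (simp add: complex_is_Real_iff)
    moreover have Ima: "Im (\<tau> a) = 0" using \<tau>K[OF aK] by (simp add: complex_is_Real_iff)
    ultimately have "Im (\<tau> x) * (Re (\<tau> a) - 2 * Re (\<tau> x)) = 0" by (simp add: algebra_simps)
    moreover have "Im (\<tau> x) \<noteq> 0" using False by (simp add: complex_is_Real_iff)
    ultimately have "Re (\<tau> a) = 2 * Re (\<tau> x)" by simp
    then have "\<tau> (a - x) = cnj (\<tau> x)"
      using Ima x aF by (simp add: complex_eq_iff emb_diff[OF \<tau>_E])
    then show ?thesis using x aF by blast
  qed
qed

end

section \<open>The dichotomy\<close>

lemma has_mult_rank_unique: "has_mult_rank G r \<Longrightarrow> has_mult_rank G s \<Longrightarrow> r = s"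
  unfolding has_mult_rank_def by (metis le_antisym)

theorem theorem5p3:
  fixes F :: "complex set" and n :: nat and \<tau> :: "complex \<Rightarrow> complex"
  assumes "number_field F"
    and "field_degree \<rat> F n"
    and "n - 2 > 0"
    and "card (real_embeddings F) = n - 2"
    and "card (nonreal_embeddings F) = 2"
    and "\<tau> \<in> nonreal_embeddings F"
  shows "(odd n \<longrightarrow>
            inj_on (\<lambda>u. (cmod (\<tau> u))\<^sup>2) (totally_positive_units F) \<and> OT_rank_is F \<tau> (n - 2))
       \<and> (even n \<longrightarrow>
            (OT_rank_is F \<tau> (n - 2) \<or> OT_rank_is F \<tau> ((n - 2) div 2)) \<and>
            (OT_rank_is F \<tau> ((n - 2) div 2) \<longleftrightarrow>
               (\<exists>K. number_field K \<and> K \<subseteq> F \<and> totally_real K \<and> field_degree K F 2)))"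
proof -
  obtain b where b: "\<forall>i<n. b i \<in> F"
    "\<forall>x\<in>F. \<exists>!c :: nat \<Rightarrow> complex. (\<forall>i<n. c i \<in> \<rat>) \<and> (\<forall>i\<ge>n. c i = 0) \<and> x = (\<Sum>i<n. c i * b i)"
    using assms(2) unfolding field_degree_def by blast
  have "embeddings F = real_embeddings F \<union> nonreal_embeddings F"
    "real_embeddings F \<inter> nonreal_embeddings F = {}"
    by (auto simp: real_embeddings_def nonreal_embeddings_def)
  moreover have "finite (real_embeddings F)" "finite (nonreal_embeddings F)"
    using assms(3,4,5) by (auto intro: card_ge_0_finite)
  ultimately have card_E: "card (embeddings F) = n"
    using assms(3,4,5) by (simp add: card_Un_disjoint)
  interpret OT_field F n b \<tau>
    by unfold_locales
      (use assms b card_E in \<open>simp_all add: number_field_def\<close>)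
  \<comment> \<open>The split is by stability, not by parity: stability forces \<open>n\<close> to
    be even and gives half the rank, while its failure makes the kernel trivial and gives the full
    rank for either parity. Uniqueness of the rank then excludes the half rank, since
    \<open>n - 2\<close> is positive.\<close>
  show ?thesis
  proof (cases conj_stable)
    case True
    have "\<exists>K. number_field K \<and> K \<subseteq> F \<and> totally_real K \<and> field_degree K F 2"
      using True by (rule conj_stable_imp_quadratic)
    then show ?thesis using rank_conj_stable[OF True] by blast
  next
    case False
    then have triv: "u = 1" if "u \<in> U" "cmod (\<tau> u) = 1" for u
      using kernel_imp_conj_stable that by blast
    have rank: "OT_rank_is F \<tau> (n - 2)" using triv by (rule rank_trivial_kernel)
    moreover have "inj_on (\<lambda>u. (cmod (\<tau> u))\<^sup>2) U" using triv by (rule inj_on_dilation)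
    moreover have "\<not> OT_rank_is F \<tau> ((n - 2) div 2)"
    proof
      assume "OT_rank_is F \<tau> ((n - 2) div 2)"
      then have "n - 2 = (n - 2) div 2" using rank has_mult_rank_unique unfolding OT_rank_is_def by blast
      then show False using assms(3) by simp
    qed
    moreover have "\<not> (\<exists>K. number_field K \<and> K \<subseteq> F \<and> totally_real K \<and> field_degree K F 2)"
      using quadratic_imp_conj_stable False by blast
    ultimately show ?thesis by blast
  qed
qed

end
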